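(* Let $\mathcal H$ and $\mathcal K$ be Hilbert spaces and let $A_1,A_2\in L(\mathcal H,\mathcal K)\setminus\{0\}$ be operators with closed ranges. Let $A_j=Q_j|A_j|$ be the polar decomposition of $A_j$, and let $\sigma_j$ denote the smallest positive spectral value of $|A_j|=(A_j^*A_j)^{1/2}$, $j=1,2$. Then $$\|Q_1-Q_2\|\le\left(\frac{3}{\sigma_1+\sigma_2}+\frac{1}{\min\{\sigma_1,\sigma_2\}}\right)\|A_1-A_2\|.$$ If, moreover, $$\hat\delta(R(A_1),R(A_2))<1\qquad\text{or}\qquad\hat\delta(N(A_1),N(A_2))<1,$$ then $\min$ in this estimate can be replaced by $\max$, i.e. $$\|Q_1-Q_2\|\le\left(\frac{3}{\sigma_1+\sigma_2}+\frac{1}{\max\{\sigma_1,\sigma_2\}}\right)\|A_1-A_2\|,$$ so that, in this case, $$\|Q_1-Q_2\|\le\frac{5}{\sigma_1+\sigma_2}\,\|A_1-A_2\|.$$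
   Context: All Hilbert spaces are complex and may be infinite-dimensional. $L(\mathcal H,\mathcal K)$ is the set of bounded linear operators from $\mathcal H$ to $\mathcal K$, and $\|\cdot\|$ is the operator norm. $R(A)$ and $N(A)$ denote the range and kernel of $A$. The polar decomposition of $A$ is the unique representation $A=Q|A|$ with $|A|=(A^*A)^{1/2}$ and $Q\in L(\mathcal H,\mathcal K)$ a partial isometry (isometric on $N(Q)^\perp$) with $N(Q)=N(A)$. For $A\ne0$ with closed range, the smallest positive spectral value of $|A|$ is $\inf(\sigma(|A|)\setminus\{0\})$, where $\sigma(|A|)$ is the spectrum of $|A|$; it is known that this number is positive. For a closed subspace $M$, $P_M$ is the orthogonal projection onto $M$. For closed subspaces $V,W$ of a Hilbert space, the gap from $V$ to $W$ is $\delta(V,W):=\sup\{\|v-P_Wv\|: v\in V,\ \|v\|=1\}=\|(I-P_W)|V\|$, the norm of the restriction of $I-P_W$ to $V$ (equal to $0$ if $V=\{0\}$), and the gap between $V$ and $W$ is $\hat\delta(V,W):=\max\{\delta(V,W),\delta(W,V)\}$. *)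

theory Defs
  imports "HOL-Analysis.Analysis"
begin

text \<open>
  Complex inner product spaces are built on top of the library's real inner product spaces, so that
  norm, metric and topology are inherited; the real inner product is required to be the real part of
  the complex one. Positive definiteness of the complex inner product is therefore inherited as well.
  The complex inner product is linear in its first argument.
\<close>

class complex_inner = real_inner +
  fixes scaleC :: "complex \<Rightarrow> 'a \<Rightarrow> 'a"  (infixr "*\<^sub>C" 75)
    and cinner :: "'a \<Rightarrow> 'a \<Rightarrow> complex"
  assumes scaleC_add_right: "c *\<^sub>C (x + y) = c *\<^sub>C x + c *\<^sub>C y"
    and scaleC_add_left: "(c + d) *\<^sub>C x = c *\<^sub>C x + d *\<^sub>C x"
    and scaleC_scaleC: "c *\<^sub>C d *\<^sub>C x = (c * d) *\<^sub>C x"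
    and scaleC_of_real: "complex_of_real r *\<^sub>C x = r *\<^sub>R x"
    and cinner_commute: "cinner x y = cnj (cinner y x)"
    and cinner_add_left: "cinner (x + y) z = cinner x z + cinner y z"
    and cinner_scaleC_left: "cinner (c *\<^sub>C x) y = c * cinner x y"
    and inner_eq_Re_cinner: "inner x y = Re (cinner x y)"

lemma cinner_self: "cinner x x = complex_of_real ((norm x)\<^sup>2)"
  for x :: "'a::complex_inner"
proof (rule complex_eqI)
  show "Re (cinner x x) = Re (complex_of_real ((norm x)\<^sup>2))"
    by (simp add: inner_eq_Re_cinner[symmetric] power2_norm_eq_inner)
  have "Im (cinner x x) = - Im (cinner x x)"
    using arg_cong[OF cinner_commute[of x x], of Im] by simp
  then show "Im (cinner x x) = Im (complex_of_real ((norm x)\<^sup>2))" by simp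
qed

class chilbert_space = complex_inner + banach

instantiation complex :: chilbert_space
begin

definition scaleC_complex :: "complex \<Rightarrow> complex \<Rightarrow> complex"
  where "scaleC_complex c x = c * x"

definition cinner_complex :: "complex \<Rightarrow> complex \<Rightarrow> complex"
  where "cinner_complex x y = x * cnj y"

instance
  by standard
    (simp_all add: scaleC_complex_def cinner_complex_def inner_complex_def algebra_simps
      scaleR_conv_of_real)

end

definition bounded_clinear :: "('a::complex_inner \<Rightarrow> 'b::complex_inner) \<Rightarrow> bool"
  where "bounded_clinear A \<longleftrightarrow> bounded_linear A \<and> (\<forall>c x. A (c *\<^sub>C x) = c *\<^sub>C A x)"

definition null_space :: "('a::complex_inner \<Rightarrow> 'b::complex_inner) \<Rightarrow> 'a set"
  where "null_space A = {x. A x = 0}"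

definition orth_compl :: "'a::complex_inner set \<Rightarrow> 'a set"
  where "orth_compl S = {x. \<forall>y\<in>S. cinner x y = 0}"

text \<open>
  The definite descriptions below denote the intended objects only where existence and uniqueness
  hold: adjoints for bounded operators between Hilbert spaces, square roots for positive operators,
  projections for closed subspaces.
\<close>

definition cadjoint :: "('a::chilbert_space \<Rightarrow> 'b::chilbert_space) \<Rightarrow> 'b \<Rightarrow> 'a"
  where "cadjoint A = (THE B. bounded_clinear B \<and> (\<forall>x y. cinner (A x) y = cinner x (B y)))"

definition positive_op :: "('a::chilbert_space \<Rightarrow> 'a) \<Rightarrow> bool"
  where "positive_op P \<longleftrightarrow> bounded_clinear P \<and> (\<forall>x. cinner (P x) x \<in> \<real>\<^sub>\<ge>\<^sub>0)"

definition sqrt_op :: "('a::chilbert_space \<Rightarrow> 'a) \<Rightarrow> 'a \<Rightarrow> 'a"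
  where "sqrt_op T = (THE P. positive_op P \<and> P \<circ> P = T)"

definition abs_op :: "('a::chilbert_space \<Rightarrow> 'b::chilbert_space) \<Rightarrow> 'a \<Rightarrow> 'a"
  where "abs_op A = sqrt_op (cadjoint A \<circ> A)"

definition partial_isometry :: "('a::chilbert_space \<Rightarrow> 'b::chilbert_space) \<Rightarrow> bool"
  where "partial_isometry Q \<longleftrightarrow>
    bounded_clinear Q \<and> (\<forall>x \<in> orth_compl (null_space Q). norm (Q x) = norm x)"

text \<open>\<open>polar_decomposition A Q\<close> says that \<open>A = Q |A|\<close> is the polar decomposition of \<open>A\<close>.\<close>

definition polar_decomposition ::
    "('a::chilbert_space \<Rightarrow> 'b::chilbert_space) \<Rightarrow> ('a \<Rightarrow> 'b) \<Rightarrow> bool"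
  where "polar_decomposition A Q \<longleftrightarrow>
    partial_isometry Q \<and> null_space Q = null_space A \<and> A = Q \<circ> abs_op A"

definition spectrum_op :: "('a::chilbert_space \<Rightarrow> 'a) \<Rightarrow> complex set"
  where "spectrum_op T =
    {z. \<not> (\<exists>S. bounded_clinear S \<and>
              S \<circ> (\<lambda>x. T x - z *\<^sub>C x) = id \<and> (\<lambda>x. T x - z *\<^sub>C x) \<circ> S = id)}"

text \<open>
  The spectrum is a set of complex numbers. For a positive operator it lies on the real axis, so
  taking real parts only changes its type.
\<close>

definition smallest_pos_spectral :: "('a::chilbert_space \<Rightarrow> 'a) \<Rightarrow> real"
  where "smallest_pos_spectral T = Inf (Re ` (spectrum_op T - {0}))"

definition orth_proj :: "'a::chilbert_space set \<Rightarrow> 'a \<Rightarrow> 'a"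
  where "orth_proj M x = (THE y. y \<in> M \<and> x - y \<in> orth_compl M)"

text \<open>The case distinction is needed because the supremum of the empty set of reals is unspecified.\<close>

definition gap_from :: "'a::chilbert_space set \<Rightarrow> 'a set \<Rightarrow> real"
  where "gap_from V W =
    (if V = {0} then 0 else Sup {norm (v - orth_proj W v) | v. v \<in> V \<and> norm v = 1})"

definition gap :: "'a::chilbert_space set \<Rightarrow> 'a set \<Rightarrow> real"
  where "gap V W = max (gap_from V W) (gap_from W V)"

end

theory Submission
  imports Defs
begin

text \<open>
  Write \<open>E = A\<^sub>1 - A\<^sub>2\<close>, and let \<open>P\<^sub>j\<close>, \<open>R\<^sub>j\<close> be the projections onto \<open>N(A\<^sub>j)\<^sup>\<bottom>\<close> and \<open>R(A\<^sub>j)\<close>. Then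
  \<open>Q\<^sub>1 - Q\<^sub>2 = R\<^sub>1 (Q\<^sub>1 - Q\<^sub>2) P\<^sub>2 + Q\<^sub>1 (I - P\<^sub>2) - (I - R\<^sub>1) Q\<^sub>2\<close>.
  The first term solves a Sylvester equation whose right-hand side has norm at most \<open>2 \<parallel>E\<parallel>\<close> and whose
  coefficients are bounded below by \<open>\<sigma>\<^sub>1\<close> and \<open>\<sigma>\<^sub>2\<close>, so its norm is at most \<open>2 \<parallel>E\<parallel> / (\<sigma>\<^sub>1 + \<sigma>\<^sub>2)\<close>. The
  last two terms have orthogonal ranges and orthogonal initial spaces, and norms at most
  \<open>\<parallel>E\<parallel> / \<sigma>\<^sub>1\<close> and \<open>\<parallel>E\<parallel> / \<sigma>\<^sub>2\<close>, so their sum is bounded by the larger of the two.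

  For the refined estimate let \<open>\<sigma>\<^sub>1 \<ge> \<sigma>\<^sub>2\<close>; only \<open>(I - R\<^sub>1) R\<^sub>2\<close> must be improved, and only if
  \<open>\<parallel>E\<parallel> < \<sigma>\<^sub>1\<close>. Then \<open>\<parallel>(I - R\<^sub>2) R\<^sub>1\<parallel> \<le> \<parallel>E\<parallel> / \<sigma>\<^sub>1 < 1\<close>, and either gap condition makes \<open>R\<^sub>1\<close> injective on
  \<open>R(A\<^sub>2)\<close>, in which case the two one-sided gaps between the ranges agree.

  Apart from the identification of \<open>\<sigma>\<^sub>j\<close> as the infimum of the form of \<open>|A\<^sub>j|\<close> on unit vectors of
  \<open>N(A\<^sub>j)\<^sup>\<bottom>\<close>, only the underlying real Hilbert space structure matters.
\<close>

section \<open>Real Hilbert spaces\<close>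

lemma mem_orthogonal_comp_iff: "x \<in> W\<^sup>\<bottom> \<longleftrightarrow> (\<forall>y\<in>W. inner y x = 0)"
  by (simp add: orthogonal_comp_def orthogonal_def)

lemma mem_orthogonal_comp_iff': "x \<in> W\<^sup>\<bottom> \<longleftrightarrow> (\<forall>y\<in>W. inner x y = 0)"
  by (simp add: mem_orthogonal_comp_iff inner_commute)

lemma closed_orthogonal_comp: "closed (W\<^sup>\<bottom>)"
proof -
  have "W\<^sup>\<bottom> = (\<Inter>y\<in>W. {x. inner y x = 0})"
    by (auto simp: mem_orthogonal_comp_iff)
  moreover have "closed {x. inner y x = 0}" for y :: 'a
    by (intro closed_Collect_eq continuous_intros)
  ultimately show ?thesis by auto
qed

lemma norm_add_sq: "(norm (x + y))\<^sup>2 = (norm x)\<^sup>2 + 2 * inner x y + (norm y)\<^sup>2"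
  for x y :: "'a::real_inner"
  by (simp add: power2_norm_eq_inner inner_add_left inner_add_right inner_commute)

lemma norm_diff_sq: "(norm (x - y))\<^sup>2 = (norm x)\<^sup>2 - 2 * inner x y + (norm y)\<^sup>2"
  for x y :: "'a::real_inner"
  by (simp add: power2_norm_eq_inner inner_diff_left inner_diff_right inner_commute)

lemma pythagoras: "inner x y = 0 \<Longrightarrow> (norm (x + y))\<^sup>2 = (norm x)\<^sup>2 + (norm y)\<^sup>2"
  for x y :: "'a::real_inner"
  by (simp add: norm_add_sq)

lemma norm_le_norm_add_orthogonal: "inner x y = 0 \<Longrightarrow> norm x \<le> norm (x + y)"
  for x y :: "'a::real_inner"
  by (rule power2_le_imp_le) (simp_all add: pythagoras)

lemma bounded_linear_subspace_null:
  assumes "bounded_linear A"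
  shows "subspace {x. A x = 0}" "closed {x. A x = 0}"
proof -
  interpret bounded_linear A by fact
  show "subspace {x. A x = 0}" by (auto simp: subspace_def add scale zero)
  show "closed {x. A x = 0}"
    by (intro closed_Collect_eq continuous_intros linear_continuous_on assms)
qed

section \<open>Nearest points, Riesz representation and adjoints\<close>

lemma orthogonal_decomposition:
  fixes M :: "'a::{real_inner,banach} set"
  assumes "subspace M" and "closed M"
  obtains y where "y \<in> M" "x - y \<in> M\<^sup>\<bottom>"
proof -
  define d where "d = infdist x M"
  have ne: "M \<noteq> {}" using assms(1) subspace_0 by blast
  have dle: "d \<le> norm (x - y)" if "y \<in> M" for y
    unfolding d_def using infdist_le[OF that] by (simp add: dist_norm)
  have d0: "d \<ge> 0" by (simp add: d_def infdist_nonneg)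
  have "\<exists>y\<in>M. (norm (x - y))\<^sup>2 < d\<^sup>2 + 1 / real (Suc n)" for n
  proof -
    have "d < sqrt (d\<^sup>2 + 1 / real (Suc n))"
      by (rule real_less_rsqrt) simp
    then obtain y where "y \<in> M" "dist x y < sqrt (d\<^sup>2 + 1 / real (Suc n))"
      unfolding d_def infdist_notempty[OF ne]
      by (subst (asm) cINF_less_iff) (use ne in \<open>auto intro: bdd_belowI2[of _ 0]\<close>)
    moreover from this have "(norm (x - y))\<^sup>2 < (sqrt (d\<^sup>2 + 1 / real (Suc n)))\<^sup>2"
      by (intro power_strict_mono) (auto simp: dist_norm)
    ultimately show ?thesis by (intro bexI[of _ y]) simp_all
  qed
  then obtain y where y: "\<And>n. y n \<in> M" "\<And>n. (norm (x - y n))\<^sup>2 < d\<^sup>2 + 1 / real (Suc n)"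
    by metis
  \<comment> \<open>The midpoint of two members of \<open>M\<close> is again at distance at least
    \<open>d\<close> from \<open>x\<close>, so the parallelogram law makes a minimizing sequence
    Cauchy.\<close>
  have par: "(norm (y m - y n))\<^sup>2 \<le> 2 / real (Suc m) + 2 / real (Suc n)" for m n
  proof -
    have "(1/2) *\<^sub>R (y m + y n) \<in> M"
      by (intro subspace_scale subspace_add assms y)
    then have "d\<^sup>2 \<le> (norm (x - (1/2) *\<^sub>R (y m + y n)))\<^sup>2"
      using dle d0 by (simp add: power_mono)
    moreover have "(norm (y m - y n))\<^sup>2
        = 2 * (norm (x - y m))\<^sup>2 + 2 * (norm (x - y n))\<^sup>2 - 4 * (norm (x - (1/2) *\<^sub>R (y m + y n)))\<^sup>2"
      by (simp add: power2_norm_eq_inner inner_diff_left inner_diff_right inner_add_left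
          inner_add_right inner_commute algebra_simps)
    ultimately show ?thesis using y(2)[of m] y(2)[of n] by simp
  qed
  have "Cauchy y"
  proof (rule metric_CauchyI)
    fix e :: real assume e: "e > 0"
    obtain k where k: "1 / real (Suc k) < e\<^sup>2 / 4"
      using e nat_approx_posE[of "e\<^sup>2 / 4"] by auto
    have "dist (y m) (y n) < e" if "m \<ge> k" "n \<ge> k" for m n
    proof -
      have "1 / real (Suc m) \<le> 1 / real (Suc k)" "1 / real (Suc n) \<le> 1 / real (Suc k)"
        using that by (simp_all add: frac_le)
      then have "(norm (y m - y n))\<^sup>2 < e\<^sup>2" using par[of m n] k by simp
      then show ?thesis using e by (simp add: dist_norm power2_less_imp_less)
    qed
    then show "\<exists>k. \<forall>m\<ge>k. \<forall>n\<ge>k. dist (y m) (y n) < e" by blast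
  qed
  then obtain l where l: "y \<longlonglongrightarrow> l" using Cauchy_convergent_iff convergent_def by blast
  have lM: "l \<in> M" using closed_sequentially[OF assms(2)] y(1) l by blast
  have "(norm (x - l))\<^sup>2 \<le> d\<^sup>2"
  proof (rule LIMSEQ_le)
    show "(\<lambda>n. (norm (x - y n))\<^sup>2) \<longlonglongrightarrow> (norm (x - l))\<^sup>2"
      by (intro tendsto_intros l)
    have "(\<lambda>n. d\<^sup>2 + 1 / real (Suc n)) \<longlonglongrightarrow> d\<^sup>2 + 0"
      by (intro tendsto_intros) (use LIMSEQ_inverse_real_of_nat in \<open>simp add: inverse_eq_divide\<close>)
    then show "(\<lambda>n. d\<^sup>2 + 1 / real (Suc n)) \<longlonglongrightarrow> d\<^sup>2" by simp
    show "\<exists>N. \<forall>n\<ge>N. (norm (x - y n))\<^sup>2 \<le> d\<^sup>2 + 1 / real (Suc n)"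
      using y(2) less_imp_le by blast
  qed
  have "inner m (x - l) = 0" if m: "m \<in> M" for m
  proof (cases "m = 0")
    case False
    \<comment> \<open>The minimizer of the distance from \<open>x - l\<close> to the line through
      \<open>m\<close>; a nonzero inner product would give a point of \<open>M\<close> closer to
      \<open>x\<close> than \<open>d\<close>.\<close>
    define t where "t = inner m (x - l) / (norm m)\<^sup>2"
    have "l + t *\<^sub>R m \<in> M" using lM m assms(1) by (simp add: subspace_add subspace_scale)
    then have "d\<^sup>2 \<le> (norm ((x - l) - t *\<^sub>R m))\<^sup>2"
      using dle d0 by (metis diff_diff_add power_mono)
    also have "\<dots> = (norm (x - l))\<^sup>2 - 2 * t * inner m (x - l) + t\<^sup>2 * (norm m)\<^sup>2"
      by (simp add: norm_diff_sq inner_commute power_mult_distrib)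
    also have "\<dots> = (norm (x - l))\<^sup>2 - (inner m (x - l))\<^sup>2 / (norm m)\<^sup>2"
      using False by (simp add: t_def field_simps power2_eq_square)
    finally have "(inner m (x - l))\<^sup>2 / (norm m)\<^sup>2 \<le> 0"
      using \<open>(norm (x - l))\<^sup>2 \<le> d\<^sup>2\<close> by simp
    then show ?thesis using False by (simp add: divide_le_0_iff)
  qed simp
  then show thesis using that lM by (simp add: mem_orthogonal_comp_iff)
qed

text \<open>The residual of projecting \<open>x\<close> from \<open>N\<close> to \<open>M\<close>
  stays in \<open>N\<close> and is orthogonal to \<open>M\<close>, hence vanishes. Surjectivity
  arguments below end with this fact.\<close>

lemma orthogonal_comp_eq_0_imp:
  fixes M N :: "'a::{real_inner,banach} set"
  assumes "subspace M" "closed M" "subspace N" "M \<subseteq> N"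
    and "\<And>x. x \<in> N \<Longrightarrow> x \<in> M\<^sup>\<bottom> \<Longrightarrow> x = 0"
  shows "M = N"
proof (intro subset_antisym subsetI)
  fix x assume x: "x \<in> N"
  obtain y where y: "y \<in> M" "x - y \<in> M\<^sup>\<bottom>"
    using orthogonal_decomposition assms by metis
  then have "x - y = 0" using assms x by (meson subsetD subspace_diff)
  then show "x \<in> M" using y by simp
qed (use assms in auto)

lemma orthogonal_comp_orthogonal_comp:
  fixes M :: "'a::{real_inner,banach} set"
  assumes "subspace M" "closed M"
  shows "M\<^sup>\<bottom>\<^sup>\<bottom> = M"
proof (rule orthogonal_comp_eq_0_imp[symmetric, OF assms subspace_orthogonal_comp orthogonal_comp_subset])
  show "x = 0" if "x \<in> M\<^sup>\<bottom>\<^sup>\<bottom>" "x \<in> M\<^sup>\<bottom>" for x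
    using that by (auto simp: mem_orthogonal_comp_iff[of x "M\<^sup>\<bottom>"])
qed

lemma riesz_representation:
  fixes f :: "'a::{real_inner,banach} \<Rightarrow> real"
  assumes "bounded_linear f"
  obtains z where "\<And>x. f x = inner x z"
proof (cases "\<forall>x. f x = 0")
  case True
  then show ?thesis using that[of 0] by simp
next
  case False
  interpret bounded_linear f by fact
  obtain u where u: "f u \<noteq> 0" using False by blast
  obtain y where y: "f y = 0" "u - y \<in> {x. f x = 0}\<^sup>\<bottom>"
    using orthogonal_decomposition[OF bounded_linear_subspace_null[OF assms], of u] by auto
  \<comment> \<open>\<open>w\<close> spans the orthogonal complement of the kernel, so modulo the
    kernel every \<open>x\<close> is the multiple \<open>f x / f w\<close> of
    \<open>w\<close>.\<close>
  define w where "w = u - y"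
  have fw: "f w \<noteq> 0" using u y by (simp add: w_def diff)
  then have w0: "w \<noteq> 0" using zero by auto
  have "f x = inner x ((f w / (norm w)\<^sup>2) *\<^sub>R w)" for x
  proof -
    have "f (x - (f x / f w) *\<^sub>R w) = 0" using fw by (simp add: diff scale)
    then have "inner (x - (f x / f w) *\<^sub>R w) w = 0"
      using y(2) by (auto simp: mem_orthogonal_comp_iff w_def)
    then have "inner x w = f x / f w * (norm w)\<^sup>2"
      by (simp add: inner_diff_left power2_norm_eq_inner)
    then show ?thesis using fw w0 by simp
  qed
  then show ?thesis using that by blast
qed

lemma adjoint_exists:
  fixes A :: "'a::{real_inner,banach} \<Rightarrow> 'b::real_inner"
  assumes "bounded_linear A"
  obtains B where "bounded_linear B" "\<And>x y. inner (A x) y = inner x (B y)"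
proof -
  have "\<exists>z. \<forall>x. inner (A x) y = inner x z" for y
    using riesz_representation[of "\<lambda>x. inner (A x) y"]
      bounded_linear_compose[OF bounded_linear_inner_left assms] by metis
  then obtain B where B: "\<And>x y. inner (A x) y = inner x (B y)" by metis
  have "bounded_linear B"
  proof (rule bounded_linear_intro)
    show "B (x + y) = B x + B y" for x y
    proof -
      have "inner u (B (x + y) - (B x + B y)) = 0" for u
        by (simp add: inner_diff_right inner_add_right flip: B)
      then show ?thesis by (metis inner_eq_zero_iff right_minus_eq)
    qed
    show "B (r *\<^sub>R x) = r *\<^sub>R B x" for r x
    proof -
      have "inner u (B (r *\<^sub>R x) - r *\<^sub>R B x) = 0" for u
        by (simp add: inner_diff_right flip: B)
      then show ?thesis by (metis inner_eq_zero_iff right_minus_eq)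
    qed
    show "norm (B y) \<le> norm y * onorm A" for y
    proof -
      have "(norm (B y))\<^sup>2 = inner (A (B y)) y" by (simp add: B power2_norm_eq_inner)
      also have "\<dots> \<le> norm (A (B y)) * norm y" by (rule norm_cauchy_schwarz)
      also have "\<dots> \<le> onorm A * norm (B y) * norm y"
        by (intro mult_right_mono onorm assms) simp
      finally have "norm (B y) * norm (B y) \<le> norm (B y) * (norm y * onorm A)"
        by (simp add: power2_eq_square mult_ac)
      then show ?thesis
        by (cases "B y = 0") (auto simp: onorm_pos_le[OF assms])
    qed
  qed
  then show ?thesis using that B by blast
qed

section \<open>Uniform boundedness and closed ranges\<close>

lemma closed_image_bounded_below:
  fixes A :: "'a::banach \<Rightarrow> 'b::real_normed_vector"
  assumes "bounded_linear A" "subspace M" "closed M" "c > 0"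
    and below: "\<And>x. x \<in> M \<Longrightarrow> c * norm x \<le> norm (A x)"
  shows "closed (A ` M)"
  unfolding closed_sequential_limits
proof (intro allI impI, elim conjE)
  interpret bounded_linear A by fact
  fix Y l assume "\<forall>n. Y n \<in> A ` M" and Y: "Y \<longlonglongrightarrow> l"
  then have "\<forall>n. \<exists>x. x \<in> M \<and> Y n = A x" by blast
  then obtain X where X: "\<And>n. X n \<in> M" "\<And>n. Y n = A (X n)" by metis
  have "Cauchy X"
  proof (rule metric_CauchyI)
    fix e :: real assume "e > 0"
    then have "c * e > 0" using assms by simp
    then obtain N where N: "\<And>m n. m \<ge> N \<Longrightarrow> n \<ge> N \<Longrightarrow> dist (Y m) (Y n) < c * e"
      using metric_CauchyD[OF LIMSEQ_imp_Cauchy[OF Y]] by blast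
    have "dist (X m) (X n) < e" if "m \<ge> N" "n \<ge> N" for m n
    proof -
      have "c * norm (X m - X n) \<le> norm (A (X m - X n))"
        by (intro below subspace_diff assms X)
      also have "\<dots> < c * e" using N[OF that] by (simp add: X diff dist_norm)
      finally show ?thesis using assms by (simp add: dist_norm)
    qed
    then show "\<exists>N. \<forall>m\<ge>N. \<forall>n\<ge>N. dist (X m) (X n) < e" by blast
  qed
  then obtain x where x: "X \<longlonglongrightarrow> x" using Cauchy_convergent_iff convergent_def by blast
  then have "x \<in> M" using closed_sequentially[OF assms(3)] X(1) by blast
  moreover have "(\<lambda>n. A (X n)) \<longlonglongrightarrow> A x" by (rule tendsto[OF x])
  then have "A x = l" using Y LIMSEQ_unique unfolding X(2)[abs_def] by blast
  ultimately show "l \<in> A ` M" by blast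
qed

lemma bounded_linear_subspace_image:
  "bounded_linear A \<Longrightarrow> subspace M \<Longrightarrow> subspace (A ` M)"
  by (simp add: bounded_linear.linear linear_subspace_image)

text \<open>Uniform boundedness principle: the closed sets \<open>F n\<close> cover the space, so by
  Baire's theorem one of them contains a ball.\<close>

lemma weakly_bounded_imp_bounded:
  fixes W :: "'a::{real_inner,banach} set"
  assumes "\<And>y. \<exists>C. \<forall>w\<in>W. \<bar>inner y w\<bar> \<le> C"
  obtains C where "\<And>w. w \<in> W \<Longrightarrow> norm w \<le> C"
proof -
  define F where "F n = {y. \<forall>w\<in>W. \<bar>inner y w\<bar> \<le> real n}" for n
  have cl: "closed (F n)" for n
  proof -
    have "F n = (\<Inter>w\<in>W. {y. \<bar>inner y w\<bar> \<le> real n})" by (auto simp: F_def)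
    moreover have "closed {y. \<bar>inner y w\<bar> \<le> real n}" for w
      by (intro closed_Collect_le continuous_intros)
    ultimately show ?thesis by auto
  qed
  have "(\<Union>n. F n) = UNIV"
  proof (intro equalityI subsetI UNIV_I)
    fix y
    obtain C where C: "\<forall>w\<in>W. \<bar>inner y w\<bar> \<le> C" using assms by blast
    obtain n where "C \<le> real n" using real_arch_simple by blast
    then have "y \<in> F n" using C by (force simp: F_def)
    then show "y \<in> (\<Union>n. F n)" by blast
  qed
  then have "\<exists>n. interior (F n) \<noteq> {}"
    using Baire_category_alt[of euclidean "range F"] cl completely_metrizable_space_euclidean
    by (fastforce simp flip: closed_closedin)
  then obtain n x e where e: "e > 0" "ball x e \<subseteq> F n" by (meson equals0I mem_interior)
  have "norm w \<le> 4 * real n / e" if w: "w \<in> W" for w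
  proof (cases "w = 0")
    case False
    \<comment> \<open>\<open>v\<close> points along \<open>w\<close> with length
      \<open>e / 2\<close>, so \<open>x\<close> and \<open>x + v\<close> both lie in the ball;
      subtracting their bounds isolates \<open>inner v w\<close>.\<close>
    define v where "v = (e / 2 / norm w) *\<^sub>R w"
    have "x + v \<in> ball x e" "x \<in> ball x e" using False e by (auto simp: v_def dist_norm)
    then have "\<bar>inner (x + v) w\<bar> \<le> n" "\<bar>inner x w\<bar> \<le> n" using e w by (auto simp: F_def subset_iff)
    then have "inner v w \<le> 2 * real n" by (simp add: inner_add_left)
    moreover have "inner v w = e / 2 * norm w"
      using False by (simp add: v_def field_simps power2_eq_square flip: power2_norm_eq_inner)
    ultimately show ?thesis using e by (simp add: field_simps)
  qed (use e in simp)
  then show ?thesis using that by blast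
qed

text \<open>Uniform boundedness first gives a lower bound for the adjoint \<open>B\<close> on the
  range of \<open>A\<close>. Then \<open>B\<close> maps this range onto the complement of the
  kernel, and writing \<open>x = B w\<close> gives \<open>inner x x = inner (A x) w\<close>, which
  transfers the bound to \<open>A\<close>.\<close>

lemma closed_range_bounded_below:
  fixes A :: "'a::{real_inner,banach} \<Rightarrow> 'b::{real_inner,banach}"
  assumes "bounded_linear A" "closed (range A)"
  obtains c where "c > 0" "\<And>x. x \<in> {x. A x = 0}\<^sup>\<bottom> \<Longrightarrow> c * norm x \<le> norm (A x)"
proof -
  interpret A: bounded_linear A by fact
  obtain B where B: "bounded_linear B" "\<And>x y. inner (A x) y = inner x (B y)"
    using adjoint_exists[OF assms(1)] by metis
  interpret B: bounded_linear B by fact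
  have R: "subspace (range A)" using bounded_linear_subspace_image[OF assms(1) subspace_UNIV] .
  \<comment> \<open>A norm bound on \<open>W\<close> is a lower bound for \<open>B\<close>.
    \<open>W\<close> is weakly bounded because only the component \<open>A z\<close> of
    \<open>y\<close> in the range matters, and \<open>inner (A z) w = inner z (B w)\<close>.\<close>
  define W where "W = {w \<in> range A. norm (B w) \<le> 1}"
  have "\<exists>C. \<forall>w\<in>W. \<bar>inner y w\<bar> \<le> C" for y
  proof -
    obtain z where z: "y - A z \<in> (range A)\<^sup>\<bottom>"
      using orthogonal_decomposition[OF R assms(2)] by (metis imageE)
    have "\<bar>inner y w\<bar> \<le> norm z" if "w \<in> W" for w
    proof -
      have "inner (y - A z) w = 0" using that z by (auto simp: W_def mem_orthogonal_comp_iff')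
      then have "inner y w = inner z (B w)" by (simp add: inner_diff_left B)
      then have "\<bar>inner y w\<bar> \<le> norm z * norm (B w)" by (simp add: Cauchy_Schwarz_ineq2)
      also have "\<dots> \<le> norm z * 1" using that by (intro mult_left_mono) (auto simp: W_def)
      finally show ?thesis by simp
    qed
    then show ?thesis by blast
  qed
  then obtain C0 where C0: "\<And>w. w \<in> W \<Longrightarrow> norm w \<le> C0" using weakly_bounded_imp_bounded by blast
  define C where "C = max C0 1"
  have C: "C > 0" "\<And>w. w \<in> W \<Longrightarrow> norm w \<le> C" using C0 by (force simp: C_def)+
  have below: "norm w \<le> C * norm (B w)" if w: "w \<in> range A" for w
  proof (cases "B w = 0")
    case True
    have "w = 0"
    proof (rule ccontr)
      assume "w \<noteq> 0"
      \<comment> \<open>If \<open>B w = 0\<close>, every multiple of \<open>w\<close> belongs to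
        \<open>W\<close>; this one has norm \<open>2 * C\<close>.\<close>
      have "(2 * C / norm w) *\<^sub>R w \<in> W"
        unfolding W_def using w True by (auto simp: B.scale intro: subspace_scale[OF R])
      from C(2)[OF this] show False using \<open>w \<noteq> 0\<close> C(1) by simp
    qed
    then show ?thesis by simp
  next
    case False
    have "(1 / norm (B w)) *\<^sub>R w \<in> W"
      unfolding W_def using w False by (auto simp: B.scale intro: subspace_scale[OF R])
    from C(2)[OF this] show ?thesis using False by (simp add: field_simps)
  qed
  have Bsub: "B ` range A \<subseteq> {x. A x = 0}\<^sup>\<bottom>"
  proof
    fix v assume "v \<in> B ` range A"
    then obtain w where "v = B w" by blast
    then show "v \<in> {x. A x = 0}\<^sup>\<bottom>" by (simp add: mem_orthogonal_comp_iff B(2)[symmetric])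
  qed
  have cl: "closed (B ` range A)"
    by (rule closed_image_bounded_below[OF B(1) R assms(2), of "1/C"])
      (use below C in \<open>auto simp: field_simps\<close>)
  have null: "x = 0" if x: "x \<in> {x. A x = 0}\<^sup>\<bottom>" "x \<in> (B ` range A)\<^sup>\<bottom>" for x
  proof -
    have "inner x (B (A x)) = 0" using x(2) by (auto simp: mem_orthogonal_comp_iff')
    then have "inner (A x) (A x) = 0" using B(2)[of x "A x"] by metis
    then have "x \<in> {x. A x = 0}" by simp
    then have "inner x x = 0" using x(1) unfolding mem_orthogonal_comp_iff by blast
    then show "x = 0" by simp
  qed
  have eq: "B ` range A = {x. A x = 0}\<^sup>\<bottom>"
    using orthogonal_comp_eq_0_imp[OF bounded_linear_subspace_image[OF B(1) R] cl
        subspace_orthogonal_comp Bsub null] by blast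
  then have "1 / C * norm x \<le> norm (A x)" if "x \<in> {x. A x = 0}\<^sup>\<bottom>" for x
  proof -
    have "x \<in> B ` range A" using that by (simp only: eq)
    then obtain w where w: "w \<in> range A" "x = B w" by (rule imageE)
    have "norm x * norm x = inner x x" by (metis power2_norm_eq_inner power2_eq_square)
    also have "\<dots> = inner (A x) w" using B(2)[of x w] w(2) by simp
    also have "\<dots> \<le> norm (A x) * norm w" by (rule norm_cauchy_schwarz)
    also have "\<dots> \<le> norm (A x) * (C * norm x)" using below[OF w(1)] w by (intro mult_left_mono) auto
    finally have "norm x * norm x \<le> norm x * (C * norm (A x))" by (simp add: mult_ac)
    then show ?thesis using C by (cases "x = 0") (auto simp: field_simps)
  qed
  then show ?thesis using that[of "1/C"] C by auto
qed

section \<open>Projections between two closed subspaces\<close>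

lemma orthogonal_projection_exists:
  fixes M :: "'a::{real_inner,banach} set"
  assumes M: "subspace M" "closed M"
  obtains P where "bounded_linear P" "\<And>x. P x \<in> M" "\<And>x. x - P x \<in> M\<^sup>\<bottom>"
proof -
  have "\<exists>y. y \<in> M \<and> x - y \<in> M\<^sup>\<bottom>" for x
    using orthogonal_decomposition[OF M] by metis
  then obtain P where P: "\<And>x. P x \<in> M" "\<And>x. x - P x \<in> M\<^sup>\<bottom>" by metis
  have uniq: "P x = y" if "y \<in> M" "x - y \<in> M\<^sup>\<bottom>" for x y
  proof -
    have "(x - y) - (x - P x) \<in> M\<^sup>\<bottom>"
      by (intro subspace_diff subspace_orthogonal_comp that P)
    moreover have "P x - y \<in> M" by (intro subspace_diff M that P)
    ultimately have "inner (P x - y) (P x - y) = 0" by (auto simp: mem_orthogonal_comp_iff)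
    then show ?thesis by simp
  qed
  have "bounded_linear P"
  proof (rule bounded_linear_intro)
    show "P (x + y) = P x + P y" for x y
    proof (rule uniq)
      have "(x - P x) + (y - P y) \<in> M\<^sup>\<bottom>" by (intro subspace_add subspace_orthogonal_comp P)
      then show "x + y - (P x + P y) \<in> M\<^sup>\<bottom>" by (simp add: algebra_simps)
    qed (intro subspace_add M P)
    show "P (r *\<^sub>R x) = r *\<^sub>R P x" for r x
    proof (rule uniq)
      have "r *\<^sub>R (x - P x) \<in> M\<^sup>\<bottom>" by (intro subspace_scale subspace_orthogonal_comp P)
      then show "r *\<^sub>R x - r *\<^sub>R P x \<in> M\<^sup>\<bottom>" by (simp add: algebra_simps)
    qed (intro subspace_scale M P)
    show "norm (P x) \<le> norm x * 1" for x
    proof -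
      have "inner (P x) (x - P x) = 0" using P by (auto simp: mem_orthogonal_comp_iff)
      from norm_le_norm_add_orthogonal[OF this] show ?thesis by simp
    qed
  qed
  then show ?thesis using that P by blast
qed

text \<open>By \<open>le\<close> the projection onto \<open>N\<close> is bounded below by
  \<open>1 - c\<close> on \<open>M\<close>, so its image of \<open>M\<close> is closed. A vector of
  \<open>N\<close> orthogonal to this image is orthogonal to \<open>M\<close> itself, since
  \<open>m - P m\<close> is orthogonal to \<open>N\<close>; then \<open>inj\<close> applies.\<close>

lemma surjective_projection:
  fixes M N :: "'a::{real_inner,banach} set"
  assumes M: "subspace M" "closed M" and N: "subspace N" "closed N" and c: "c < 1"
    and le: "\<And>x y. x \<in> M \<Longrightarrow> y \<in> N \<Longrightarrow> x - y \<in> N\<^sup>\<bottom> \<Longrightarrow> norm (x - y) \<le> c * norm x"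
    and inj: "\<And>y. y \<in> N \<Longrightarrow> y \<in> M\<^sup>\<bottom> \<Longrightarrow> y = 0"
    and y: "y \<in> N"
  obtains x where "x \<in> M" "x - y \<in> N\<^sup>\<bottom>"
proof -
  obtain P where P: "bounded_linear P" "\<And>x. P x \<in> N" "\<And>x. x - P x \<in> N\<^sup>\<bottom>"
    using orthogonal_projection_exists[OF N] by blast
  have below: "(1 - c) * norm x \<le> norm (P x)" if "x \<in> M" for x
    using le[OF that P(2) P(3)] norm_triangle_ineq2[of x "P x"] by (simp add: algebra_simps)
  have cl: "closed (P ` M)"
    using closed_image_bounded_below[OF P(1) M _ below] c by simp
  have sub: "P ` M \<subseteq> N" using P(2) by blast
  have "x = 0" if x: "x \<in> N" "x \<in> (P ` M)\<^sup>\<bottom>" for x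
  proof (rule inj[OF x(1)])
    have "inner m x = 0" if "m \<in> M" for m
    proof -
      have "inner (m - P m) x = 0" using P(3)[of m] x(1) by (auto simp: mem_orthogonal_comp_iff')
      moreover have "inner (P m) x = 0" using x(2) that by (auto simp: mem_orthogonal_comp_iff)
      ultimately show ?thesis by (simp add: inner_diff_left)
    qed
    then show "x \<in> M\<^sup>\<bottom>" by (simp add: mem_orthogonal_comp_iff)
  qed
  from orthogonal_comp_eq_0_imp[OF bounded_linear_subspace_image[OF P(1) M(1)] cl N(1) sub this]
  have "y \<in> P ` M" using y by simp
  then show ?thesis using that P(3) by blast
qed

text \<open>Half of Kato's theorem that two closed subspaces at gap less than one have the same one-sided
  gaps. With \<open>y\<close> the projection of \<open>x \<in> M\<close> to \<open>N\<close>, the distance from \<open>y\<close> to \<open>M\<close> is compared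
  with the distance to the nearest multiple of \<open>x\<close>.\<close>

lemma gap_symmetric:
  fixes M N :: "'a::{real_inner,banach} set"
  assumes M: "subspace M" "closed M" and N: "subspace N" "closed N" and c: "c < 1"
    and le: "\<And>x y. x \<in> M \<Longrightarrow> y \<in> N \<Longrightarrow> x - y \<in> N\<^sup>\<bottom> \<Longrightarrow> norm (x - y) \<le> c * norm x"
    and inj: "\<And>y. y \<in> N \<Longrightarrow> y \<in> M\<^sup>\<bottom> \<Longrightarrow> y = 0"
    and y: "y \<in> N" and r: "r \<in> M" "y - r \<in> M\<^sup>\<bottom>"
  shows "norm (y - r) \<le> c * norm y"
proof (cases "y = 0")
  case True
  then have "inner r r = 0" using r by (auto simp: mem_orthogonal_comp_iff)
  then show ?thesis using True by simp
next
  case False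
  obtain x where x: "x \<in> M" "x - y \<in> N\<^sup>\<bottom>"
    using surjective_projection[OF M N c le inj y] by blast
  have yx: "inner y (x - y) = 0" using x(2) y by (auto simp: mem_orthogonal_comp_iff)
  then have xy: "inner y x = (norm y)\<^sup>2" by (simp add: inner_diff_right power2_norm_eq_inner)
  then have x0: "norm x > 0" using False by auto
  have "0 \<le> c * norm x" using le[OF x(1) y x(2)] norm_ge_zero order_trans by blast
  then have c0: "c \<ge> 0" using x0 by (simp add: zero_le_mult_iff)
  have "(norm x)\<^sup>2 = (norm y)\<^sup>2 + (norm (x - y))\<^sup>2" using pythagoras[OF yx] by simp
  also have "\<dots> \<le> (norm y)\<^sup>2 + (c * norm x)\<^sup>2"
    using le[OF x(1) y x(2)] by (simp add: power_mono)
  finally have nx: "(1 - c\<^sup>2) * (norm x)\<^sup>2 \<le> (norm y)\<^sup>2" by (simp add: algebra_simps)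
  \<comment> \<open>Since \<open>inner y x\<close> is the squared norm of \<open>y\<close>,
    \<open>t *\<^sub>R x\<close> is the multiple of \<open>x\<close> nearest to \<open>y\<close>, at
    squared distance \<open>(1 - t) * (norm y)\<^sup>2\<close>.\<close>
  define t where "t = (norm y)\<^sup>2 / (norm x)\<^sup>2"
  have tx: "t * (norm x)\<^sup>2 = (norm y)\<^sup>2" using x0 by (simp add: t_def)
  have t1: "1 - c\<^sup>2 \<le> t" using nx x0 by (simp add: t_def field_simps)
  have "inner (y - r) (r - t *\<^sub>R x) = 0"
    using r x(1) M by (auto simp: mem_orthogonal_comp_iff' intro: subspace_diff subspace_scale)
  from pythagoras[OF this] have "(norm (y - r))\<^sup>2 \<le> (norm (y - t *\<^sub>R x))\<^sup>2" by simp
  also have "\<dots> = (norm y)\<^sup>2 - 2 * t * (norm y)\<^sup>2 + t * (t * (norm x)\<^sup>2)"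
    by (simp add: norm_diff_sq xy power_mult_distrib) (simp add: power2_eq_square)
  also have "\<dots> = (1 - t) * (norm y)\<^sup>2" by (simp add: tx algebra_simps)
  also have "\<dots> \<le> (c * norm y)\<^sup>2"
    unfolding power_mult_distrib using t1 by (intro mult_right_mono) auto
  finally show ?thesis by (rule power2_le_imp_le) (use c0 in simp)
qed

section \<open>Polar decompositions\<close>

text \<open>\<open>H\<close> stands for \<open>|A|\<close>. The number \<open>\<sigma>\<close>
  enters as a positive lower bound of the form of \<open>H\<close> on the complement of the
  kernel.\<close>

locale real_polar =
  fixes A Q :: "'a::{real_inner,banach} \<Rightarrow> 'b::{real_inner,banach}" and H :: "'a \<Rightarrow> 'a" and \<sigma> :: real
  assumes bl_A: "bounded_linear A" and bl_Q: "bounded_linear Q" and bl_H: "bounded_linear H"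
    and A_eq: "A x = Q (H x)"
    and symmetric: "inner (H x) y = inner x (H y)"
    and null_Q: "Q x = 0 \<longleftrightarrow> A x = 0"
    and null_H: "A x = 0 \<Longrightarrow> H x = 0"
    and isometric: "x \<in> {x. A x = 0}\<^sup>\<bottom> \<Longrightarrow> norm (Q x) = norm x"
    and sigma_pos: "\<sigma> > 0"
    and sigma_le: "x \<in> {x. A x = 0}\<^sup>\<bottom> \<Longrightarrow> \<sigma> * (norm x)\<^sup>2 \<le> inner (H x) x"
begin

abbreviation coimage :: "'a set" where "coimage \<equiv> {x. A x = 0}\<^sup>\<bottom>"

sublocale A: bounded_linear A by (rule bl_A)
sublocale Q: bounded_linear Q by (rule bl_Q)
sublocale H: bounded_linear H by (rule bl_H)

lemmas null_space_props = bounded_linear_subspace_null[OF bl_A]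
lemmas coimage_props = subspace_orthogonal_comp[of "{x. A x = 0}"] closed_orthogonal_comp[of "{x. A x = 0}"]

lemma coimage_comp: "coimage\<^sup>\<bottom> = {x. A x = 0}"
  by (rule orthogonal_comp_orthogonal_comp[OF null_space_props])

lemma null_decomposition:
  obtains u where "u \<in> coimage" "A (x - u) = 0"
proof -
  obtain n where n: "n \<in> {x. A x = 0}" "x - n \<in> coimage"
    using orthogonal_decomposition[OF null_space_props] by blast
  then show ?thesis using that[of "x - n"] by simp
qed

lemma null_orthogonal: "A x = 0 \<Longrightarrow> z \<in> coimage \<Longrightarrow> inner x z = 0"
  by (simp add: mem_orthogonal_comp_iff)

text \<open>Polarized isometry: the adjoint of \<open>Q\<close> times \<open>Q\<close> is the
  projection onto the coimage. The kernel part of \<open>x\<close> is killed by \<open>Q\<close> and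
  orthogonal to \<open>z\<close>.\<close>

lemma inner_Q_coimage:
  assumes z: "z \<in> coimage"
  shows "inner (Q x) (Q z) = inner x z"
proof -
  obtain u where u: "u \<in> coimage" "A (x - u) = 0" using null_decomposition by blast
  have uz: "u + z \<in> coimage" by (intro subspace_add coimage_props u z)
  have "(norm (Q (u + z)))\<^sup>2 = (norm (u + z))\<^sup>2" using isometric[OF uz] by simp
  then have "inner (Q u) (Q z) = inner u z"
    by (simp add: Q.add norm_add_sq isometric u z)
  moreover have "Q x = Q u" using u(2) null_Q[of "x - u"] by (simp add: Q.diff)
  moreover have "inner (x - u) z = 0" using null_orthogonal u(2) z by blast
  ultimately show ?thesis by (simp add: inner_diff_left)
qed

lemma H_coimage: "H x \<in> coimage"
proof -
  have "inner n (H x) = 0" if "A n = 0" for n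
    using null_H[OF that] symmetric[of n x] by simp
  then show ?thesis by (simp add: mem_orthogonal_comp_iff)
qed

lemma norm_H_ge:
  assumes "x \<in> coimage"
  shows "\<sigma> * norm x \<le> norm (H x)"
proof -
  have "\<sigma> * (norm x)\<^sup>2 \<le> norm (H x) * norm x"
    using sigma_le[OF assms] norm_cauchy_schwarz[of "H x" x] by linarith
  then have "norm x * (\<sigma> * norm x) \<le> norm x * norm (H x)" by (simp add: power2_eq_square mult_ac)
  then show ?thesis by (cases "x = 0") auto
qed

lemma norm_A_ge: "x \<in> coimage \<Longrightarrow> \<sigma> * norm x \<le> norm (A x)"
  using norm_H_ge isometric[OF H_coimage[of x]] A_eq by simp

text \<open>The image is closed because \<open>H\<close> is bounded below, and an \<open>x\<close>
  orthogonal to it satisfies \<open>inner (H x) (H x) = inner x (H (H x)) = 0\<close>. This puts the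
  range of \<open>Q\<close> inside that of \<open>A\<close>.\<close>

lemma H_image_coimage: "H ` coimage = coimage"
proof (rule orthogonal_comp_eq_0_imp[OF bounded_linear_subspace_image[OF bl_H coimage_props(1)]
      closed_image_bounded_below[OF bl_H coimage_props sigma_pos norm_H_ge] coimage_props(1)])
  show "H ` coimage \<subseteq> coimage" using H_coimage by blast
  fix x assume x: "x \<in> coimage" "x \<in> (H ` coimage)\<^sup>\<bottom>"
  then have "inner x (H (H x)) = 0" using H_coimage by (auto simp: mem_orthogonal_comp_iff')
  then have "inner (H x) (H x) = 0" using symmetric by metis
  then have "H x = 0" by simp
  then have "\<sigma> * norm x \<le> 0" using norm_H_ge[OF x(1)] by simp
  then show "x = 0" using sigma_pos by (simp add: mult_le_0_iff)
qed

lemma range_A_coimage: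
  assumes "y \<in> range A"
  obtains x where "x \<in> coimage" "y = A x"
proof -
  obtain v where v: "y = A v" using assms by blast
  obtain u where "u \<in> coimage" "A (v - u) = 0" using null_decomposition by blast
  then show ?thesis using that[of u] v by (simp add: A.diff)
qed

lemma Q_in_range: "Q x \<in> range A"
proof -
  obtain u where u: "u \<in> coimage" "A (x - u) = 0" using null_decomposition by blast
  have "u \<in> H ` coimage" using u(1) by (simp only: H_image_coimage)
  then obtain v where "u = H v" by blast
  moreover have "Q x = Q u" using u(2) null_Q[of "x - u"] by (simp add: Q.diff)
  ultimately show ?thesis using A_eq by (metis rangeI)
qed

lemma range_Q_coimage:
  assumes "y \<in> range A"
  obtains z where "z \<in> coimage" "y = Q z"
  using range_A_coimage[OF assms] A_eq H_coimage by metis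

lemma subspace_range: "subspace (range A)"
  by (rule bounded_linear_subspace_image[OF bl_A subspace_UNIV])

lemma closed_range: "closed (range A)"
proof -
  have "range A = A ` coimage" using range_A_coimage by blast
  then show ?thesis
    using closed_image_bounded_below[OF bl_A coimage_props sigma_pos norm_A_ge] by simp
qed

text \<open>Up to second order in \<open>t\<close>, the map \<open>I - t H\<close> contracts the
  coimage by the factor \<open>1 - t * \<sigma>\<close>: a discrete form of the decay of
  \<open>exp (- t H)\<close>.\<close>

lemma norm_diff_H_le:
  assumes x: "x \<in> coimage" and t: "0 \<le> t" "t * \<sigma> \<le> 1"
  shows "norm (x - t *\<^sub>R H x) \<le> (1 - t * \<sigma> + t\<^sup>2 * (onorm H)\<^sup>2 / 2) * norm x"
proof -
  \<comment> \<open>The squared norm grows at most by the factor \<open>1 + s\<close>, and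
    \<open>1 + s \<le> (1 + s / 2)\<^sup>2\<close> removes the square root;
    \<open>t * \<sigma> \<le> 1\<close> keeps \<open>1 + s / 2\<close> nonnegative.\<close>
  define s where "s = t\<^sup>2 * (onorm H)\<^sup>2 - 2 * (t * \<sigma>)"
  have "(norm (x - t *\<^sub>R H x))\<^sup>2 = (norm x)\<^sup>2 - 2 * t * inner (H x) x + t\<^sup>2 * (norm (H x))\<^sup>2"
    by (simp add: norm_diff_sq inner_commute power_mult_distrib)
  also have "\<dots> \<le> (norm x)\<^sup>2 - 2 * t * (\<sigma> * (norm x)\<^sup>2) + t\<^sup>2 * (onorm H * norm x)\<^sup>2"
    by (intro add_mono diff_mono mult_left_mono sigma_le x power_mono onorm bl_H) (use t in auto)
  also have "\<dots> = (1 + s) * (norm x)\<^sup>2" by (simp add: s_def algebra_simps)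
  also have "\<dots> \<le> (1 + s / 2)\<^sup>2 * (norm x)\<^sup>2"
    by (intro mult_right_mono) (simp_all add: power2_sum power_divide)
  also have "\<dots> = ((1 + s / 2) * norm x)\<^sup>2" by (simp add: power_mult_distrib)
  finally have "norm (x - t *\<^sub>R H x) \<le> (1 + s / 2) * norm x"
  proof (rule power2_le_imp_le)
    have "0 \<le> 1 + (p - 2 * k) / 2" if "0 \<le> p" "k \<le> 1" for p k :: real
      using that by (simp add: field_simps)
    then have "0 \<le> 1 + s / 2" unfolding s_def using t(2) by simp
    then show "0 \<le> (1 + s / 2) * norm x" by simp
  qed
  moreover have "1 + s / 2 = 1 - t * \<sigma> + t\<^sup>2 * (onorm H)\<^sup>2 / 2"
    by (simp add: s_def diff_divide_distrib)
  ultimately show ?thesis by simp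
qed

end

section \<open>The perturbation estimate in real Hilbert spaces\<close>

locale real_polar_pair =
  P1: real_polar A1 Q1 H1 \<sigma>1 + P2: real_polar A2 Q2 H2 \<sigma>2
  for A1 Q1 :: "'a::{real_inner,banach} \<Rightarrow> 'b::{real_inner,banach}" and H1 \<sigma>1
    and A2 Q2 :: "'a \<Rightarrow> 'b" and H2 \<sigma>2
begin

section \<open>The Sylvester term\<close>

definition err :: real where "err = onorm (\<lambda>x. A1 x - A2 x)"

lemma err_nonneg: "err \<ge> 0"
  unfolding err_def by (intro onorm_pos_le bounded_linear_sub P1.bl_A P2.bl_A)

lemma err_le: "norm (A1 x - A2 x) \<le> err * norm x"
  unfolding err_def by (intro onorm bounded_linear_sub P1.bl_A P2.bl_A)

text \<open>On \<open>P2.coimage \<times> P1.coimage\<close> the form \<open>defect\<close> represents the operator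
  \<open>T = R\<^sub>1 (Q\<^sub>1 - Q\<^sub>2) P\<^sub>2\<close>, and \<open>defect_sylvester\<close> is the Sylvester equation
  \<open>K\<^sub>1 T + T H\<^sub>2 = R\<^sub>1 E P\<^sub>2 - Q\<^sub>1 E\<^sup>* Q\<^sub>2\<close>, where \<open>E = A\<^sub>1 - A\<^sub>2\<close> and \<open>K\<^sub>1 = Q\<^sub>1 H\<^sub>1 Q\<^sub>1\<^sup>*\<close>.\<close>

definition defect :: "'a \<Rightarrow> 'a \<Rightarrow> real"
  where "defect x z = inner x z - inner (Q2 x) (Q1 z)"

lemma defect_sylvester:
  assumes x: "x \<in> P2.coimage" and z: "z \<in> P1.coimage"
  shows "defect (H2 x) z + defect x (H1 z)
    = inner (A1 x - A2 x) (Q1 z) - inner (Q2 x) (A1 z - A2 z)"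
proof -
  \<comment> \<open>These two values account for the terms \<open>inner x (H1 z)\<close> and
    \<open>inner (H2 x) z\<close> of the defects; in the other terms \<open>Q1 (H1 z)\<close> and
    \<open>Q2 (H2 x)\<close> fold back to \<open>A1 z\<close> and \<open>A2 x\<close>.\<close>
  have "inner (A1 x) (Q1 z) = inner x (H1 z)"
    using P1.inner_Q_coimage[OF z, of "H1 x"] by (simp add: P1.A_eq P1.symmetric)
  moreover have "inner (Q2 x) (A2 z) = inner (H2 x) z"
    using P2.inner_Q_coimage[OF x, of "H2 z"]
    by (simp add: P2.A_eq P2.symmetric inner_commute[of x] inner_commute[of "Q2 x"] inner_commute[of _ z])
  ultimately show ?thesis
    by (simp add: defect_def inner_diff_left inner_diff_right P1.A_eq[of z] P2.A_eq[of x])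
qed

lemma defect_diff_left: "defect (x - y) z = defect x z - defect y z"
  by (simp add: defect_def inner_diff_left P2.Q.diff)

lemma defect_diff_right: "defect x (y - z) = defect x y - defect x z"
  by (simp add: defect_def inner_diff_right P1.Q.diff)

lemma defect_scale_left: "defect (r *\<^sub>R x) z = r * defect x z"
  by (simp add: defect_def P2.Q.scaleR algebra_simps)

lemma defect_scale_right: "defect x (r *\<^sub>R z) = r * defect x z"
  by (simp add: defect_def P1.Q.scaleR algebra_simps)

lemma defect_minus_left: "defect (- x) z = - defect x z"
  by (simp add: defect_def P2.Q.neg)

text \<open>\<open>\<beta>\<close> is the norm of the form. The supremum runs over balls, not
  spheres, so that zero witnesses nonemptiness. That \<open>\<beta>\<close> is least, the last
  property, drives the next estimate.\<close>

lemma defect_norm_exists: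
  obtains \<beta> where "\<beta> \<ge> 0"
    "\<And>x z. x \<in> P2.coimage \<Longrightarrow> z \<in> P1.coimage \<Longrightarrow> defect x z \<le> \<beta> * (norm x * norm z)"
    "\<And>u. (\<And>x z. x \<in> P2.coimage \<Longrightarrow> z \<in> P1.coimage \<Longrightarrow> norm x \<le> 1 \<Longrightarrow> norm z \<le> 1
      \<Longrightarrow> defect x z \<le> u) \<Longrightarrow> \<beta> \<le> u"
proof -
  define S where "S = {defect x z | x z. x \<in> P2.coimage \<and> z \<in> P1.coimage \<and> norm x \<le> 1 \<and> norm z \<le> 1}"
  have bdd: "bdd_above S"
  proof (rule bdd_aboveI)
    fix s assume "s \<in> S"
    then obtain x z where xz: "s = defect x z" "x \<in> P2.coimage" "z \<in> P1.coimage"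
      "norm x \<le> 1" "norm z \<le> 1" unfolding S_def by blast
    have "inner x z \<le> norm x * norm z" "- inner (Q2 x) (Q1 z) \<le> norm (Q2 x) * norm (Q1 z)"
      using norm_cauchy_schwarz[of x z] Cauchy_Schwarz_ineq2[of "Q2 x" "Q1 z"] by auto
    moreover have "norm x * norm z \<le> 1" using xz by (simp add: mult_le_one)
    ultimately show "s \<le> 2"
      using xz P1.isometric[OF xz(3)] P2.isometric[OF xz(2)] by (simp add: defect_def)
  qed
  have "0 \<in> P2.coimage" "0 \<in> P1.coimage"
    using P1.coimage_props(1) P2.coimage_props(1) subspace_0 by blast+
  then have "defect 0 0 \<in> S" unfolding S_def by (intro CollectI exI[of _ 0]) simp
  then have S0: "0 \<in> S" by (simp add: defect_def)
  have "defect x z \<le> Sup S * (norm x * norm z)" if "x \<in> P2.coimage" "z \<in> P1.coimage" for x z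
  proof (cases "x = 0 \<or> z = 0")
    case True
    then show ?thesis by (auto simp: defect_def)
  next
    case False
    have "defect ((1 / norm x) *\<^sub>R x) ((1 / norm z) *\<^sub>R z) \<in> S"
      unfolding S_def using that False
      by (intro CollectI exI[of _ "(1 / norm x) *\<^sub>R x"] exI[of _ "(1 / norm z) *\<^sub>R z"])
        (simp add: subspace_scale P1.coimage_props P2.coimage_props)
    from cSup_upper[OF this bdd] show ?thesis
      using False by (simp add: defect_scale_left defect_scale_right field_simps)
  qed
  moreover have "Sup S \<ge> 0" using cSup_upper[OF S0 bdd] .
  moreover have "Sup S \<le> u" if "\<And>x z. x \<in> P2.coimage \<Longrightarrow> z \<in> P1.coimage \<Longrightarrow> norm x \<le> 1
      \<Longrightarrow> norm z \<le> 1 \<Longrightarrow> defect x z \<le> u" for u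
    using S0 by (intro cSup_least) (auto simp: S_def intro: that)
  ultimately show ?thesis using that by blast
qed

text \<open>A stand-in for \<open>T = \<integral>\<^sub>0\<^sup>\<infinity> exp (- t K\<^sub>1) (K\<^sub>1 T + T H\<^sub>2) exp (- t H\<^sub>2) dt\<close>: the norm \<open>\<beta>\<close> of the
  form is compared with its values at \<open>(1 - t H\<^sub>2) x\<close> and \<open>(1 - t H\<^sub>1) z\<close> for small \<open>t\<close>.\<close>

lemma defect_le:
  assumes x0: "x0 \<in> P2.coimage" and z0: "z0 \<in> P1.coimage"
  shows "defect x0 z0 \<le> 2 * err / (\<sigma>1 + \<sigma>2) * (norm x0 * norm z0)"
proof -
  obtain \<beta> where \<beta>: "\<beta> \<ge> 0"
    "\<And>x z. x \<in> P2.coimage \<Longrightarrow> z \<in> P1.coimage \<Longrightarrow> defect x z \<le> \<beta> * (norm x * norm z)"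
    "\<And>u. (\<And>x z. x \<in> P2.coimage \<Longrightarrow> z \<in> P1.coimage \<Longrightarrow> norm x \<le> 1 \<Longrightarrow> norm z \<le> 1
      \<Longrightarrow> defect x z \<le> u) \<Longrightarrow> \<beta> \<le> u"
    using defect_norm_exists by blast
  define h1 h2 where "h1 = onorm H1" and "h2 = onorm H2"
  have h: "h1 \<ge> 0" "h2 \<ge> 0" by (auto simp: h1_def h2_def onorm_pos_le P1.bl_H P2.bl_H)
  \<comment> \<open>The second-order coefficients in \<open>t\<close> of the expansion below; the
    term of order four is absorbed because \<open>t \<le> 1\<close>.\<close>
  define C where "C = h1 * h2 + \<sigma>1 * \<sigma>2 + h1\<^sup>2 / 2 + h2\<^sup>2 / 2 + h1\<^sup>2 * h2\<^sup>2 / 4"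
  have C0: "C \<ge> 0" using h P1.sigma_pos P2.sigma_pos by (simp add: C_def)
  \<comment> \<open>A bound for all values of the form on the unit balls bounds
    \<open>\<beta>\<close>. To first order it reads \<open>\<beta> \<le> 2 * t * err + \<beta> * (1
    - t * (\<sigma>1 + \<sigma>2))\<close>, so \<open>\<beta>\<close> cancels and \<open>t\<close>
    divides out.\<close>
  have step: "\<beta> * (\<sigma>1 + \<sigma>2) \<le> 2 * err + t * (\<beta> * C)"
    if t: "t > 0" "t \<le> 1" "t * \<sigma>1 \<le> 1" "t * \<sigma>2 \<le> 1" for t
  proof -
    define u where "u = t\<^sup>2 * h2\<^sup>2 / 2"
    define v where "v = t\<^sup>2 * h1\<^sup>2 / 2"
    have uv: "u \<ge> 0" "v \<ge> 0" by (auto simp: u_def v_def)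
    have "\<beta> \<le> 2 * t * err + t\<^sup>2 * (\<beta> * (h1 * h2)) + \<beta> * ((1 - t * \<sigma>2 + u) * (1 - t * \<sigma>1 + v))"
    proof (rule \<beta>(3))
      fix x z assume x: "x \<in> P2.coimage" "norm x \<le> 1" and z: "z \<in> P1.coimage" "norm z \<le> 1"
      have "norm (x - t *\<^sub>R H2 x) \<le> (1 - t * \<sigma>2 + u) * norm x"
        using P2.norm_diff_H_le[OF x(1)] t by (simp add: u_def h2_def)
      also have "\<dots> \<le> (1 - t * \<sigma>2 + u) * 1" using x t uv by (intro mult_left_mono) auto
      finally have nx: "norm (x - t *\<^sub>R H2 x) \<le> 1 - t * \<sigma>2 + u" by simp
      have "norm (z - t *\<^sub>R H1 z) \<le> (1 - t * \<sigma>1 + v) * norm z"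
        using P1.norm_diff_H_le[OF z(1)] t by (simp add: v_def h1_def)
      also have "\<dots> \<le> (1 - t * \<sigma>1 + v) * 1" using z t uv by (intro mult_left_mono) auto
      finally have nz: "norm (z - t *\<^sub>R H1 z) \<le> 1 - t * \<sigma>1 + v" by simp
      have "defect (x - t *\<^sub>R H2 x) (z - t *\<^sub>R H1 z)
          \<le> \<beta> * (norm (x - t *\<^sub>R H2 x) * norm (z - t *\<^sub>R H1 z))"
        by (intro \<beta>(2) subspace_diff subspace_scale P1.coimage_props P2.coimage_props
            x z P1.H_coimage P2.H_coimage)
      also have "\<dots> \<le> \<beta> * ((1 - t * \<sigma>2 + u) * (1 - t * \<sigma>1 + v))"
        by (intro mult_left_mono mult_mono nx nz \<beta>) (use t uv in auto)
      finally have 1: "defect (x - t *\<^sub>R H2 x) (z - t *\<^sub>R H1 z)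
          \<le> \<beta> * ((1 - t * \<sigma>2 + u) * (1 - t * \<sigma>1 + v))" .
      have h2x: "norm (H2 x) \<le> h2"
        using onorm[OF P2.bl_H, of x] mult_left_mono[OF x(2) h(2)] by (simp add: h2_def)
      have h1z: "norm (H1 z) \<le> h1"
        using onorm[OF P1.bl_H, of z] mult_left_mono[OF z(2) h(1)] by (simp add: h1_def)
      \<comment> \<open>\<open>\<beta>(2)\<close> bounds the form from above; negating one argument
        yields the lower bound.\<close>
      have "defect (- H2 x) (H1 z) \<le> \<beta> * (norm (- H2 x) * norm (H1 z))"
        by (intro \<beta>(2) P1.H_coimage subspace_neg P2.coimage_props P2.H_coimage)
      also have "\<dots> \<le> \<beta> * (h2 * h1)"
        using h2x h1z by (intro mult_left_mono mult_mono \<beta>) (auto simp: h)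
      finally have 2: "- defect (H2 x) (H1 z) \<le> \<beta> * (h1 * h2)"
        by (simp add: defect_minus_left mult_ac)
      have "inner (A1 x - A2 x) (Q1 z) \<le> norm (A1 x - A2 x) * norm (Q1 z)"
        by (rule norm_cauchy_schwarz)
      also have "\<dots> \<le> err * 1"
        using err_le[of x] mult_left_mono[OF x(2) err_nonneg] z P1.isometric[OF z(1)]
        by (intro mult_mono) (auto simp: err_nonneg)
      finally have 3: "inner (A1 x - A2 x) (Q1 z) \<le> err" by simp
      have "- inner (Q2 x) (A1 z - A2 z) \<le> norm (Q2 x) * norm (A1 z - A2 z)"
        using Cauchy_Schwarz_ineq2[of "Q2 x" "A1 z - A2 z"] by simp
      also have "\<dots> \<le> 1 * err"
        using err_le[of z] mult_left_mono[OF z(2) err_nonneg] x P2.isometric[OF x(1)]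
        by (intro mult_mono) (auto simp: err_nonneg)
      finally have 4: "- inner (Q2 x) (A1 z - A2 z) \<le> err" by simp
      have "defect (H2 x) z + defect x (H1 z) \<le> 2 * err"
        using 3 4 defect_sylvester[OF x(1) z(1)] by simp
      then have 5: "t * (defect (H2 x) z + defect x (H1 z)) \<le> t * (2 * err)"
        using t by (intro mult_left_mono) auto
      have 6: "t\<^sup>2 * - defect (H2 x) (H1 z) \<le> t\<^sup>2 * (\<beta> * (h1 * h2))"
        using 2 by (intro mult_left_mono) auto
      \<comment> \<open>Bilinear expansion at the contracted vectors, solved for
        \<open>defect x z\<close>; the coefficient of \<open>t\<close> is the left-hand side of the
        Sylvester equation.\<close>
      have "defect x z = defect (x - t *\<^sub>R H2 x) (z - t *\<^sub>R H1 z)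
          + t * (defect (H2 x) z + defect x (H1 z)) + t\<^sup>2 * - defect (H2 x) (H1 z)"
        by (simp add: defect_diff_left defect_diff_right defect_scale_left defect_scale_right
            algebra_simps power2_eq_square)
      then show "defect x z \<le> 2 * t * err + t\<^sup>2 * (\<beta> * (h1 * h2))
          + \<beta> * ((1 - t * \<sigma>2 + u) * (1 - t * \<sigma>1 + v))"
        using 1 5 6 by linarith
    qed
    also have "(1 - t * \<sigma>2 + u) * (1 - t * \<sigma>1 + v)
        = (1 - t * \<sigma>2) * (1 - t * \<sigma>1) + u * (1 - t * \<sigma>1) + v * (1 - t * \<sigma>2) + u * v"
      by (simp add: algebra_simps)
    also have "\<dots> \<le> (1 - t * \<sigma>2) * (1 - t * \<sigma>1) + u * 1 + v * 1 + t\<^sup>2 * (h1\<^sup>2 * h2\<^sup>2 / 4)"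
    proof (intro add_mono order_refl mult_left_mono)
      have "u * v = t\<^sup>2 * t\<^sup>2 * (h1\<^sup>2 * h2\<^sup>2 / 4)" by (simp add: u_def v_def)
      also have "\<dots> \<le> t\<^sup>2 * 1 * (h1\<^sup>2 * h2\<^sup>2 / 4)"
        using t by (intro mult_right_mono mult_left_mono) (auto simp: power_le_one)
      finally show "u * v \<le> t\<^sup>2 * (h1\<^sup>2 * h2\<^sup>2 / 4)" by simp
    qed (use t uv P1.sigma_pos P2.sigma_pos in auto)
    finally have "\<beta> \<le> 2 * t * err + t\<^sup>2 * (\<beta> * (h1 * h2)) + \<beta> * ((1 - t * \<sigma>2) * (1 - t * \<sigma>1)
        + u * 1 + v * 1 + t\<^sup>2 * (h1\<^sup>2 * h2\<^sup>2 / 4))"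
      using \<beta>(1) by (simp add: mult_left_mono)
    also have "\<dots> = \<beta> + t * (2 * err + t * (\<beta> * C) - \<beta> * (\<sigma>1 + \<sigma>2))"
      by (simp add: u_def v_def C_def algebra_simps power2_eq_square)
    finally have "0 \<le> t * (2 * err + t * (\<beta> * C) - \<beta> * (\<sigma>1 + \<sigma>2))" by simp
    then show ?thesis using t(1) by (simp add: zero_le_mult_iff)
  qed
  have "\<beta> * (\<sigma>1 + \<sigma>2) \<le> 2 * err"
  proof (rule field_le_epsilon)
    fix e :: real assume e: "e > 0"
    define D where "D = \<beta> * C + 1"
    have D: "D > 0" "\<beta> * C \<le> D" using \<beta>(1) C0 by (auto simp: D_def add_nonneg_pos)
    define t where "t = Min {1, 1 / \<sigma>1, 1 / \<sigma>2, e / D}"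
    have t: "t \<le> 1" "t \<le> 1 / \<sigma>1" "t \<le> 1 / \<sigma>2" "t \<le> e / D" by (auto simp: t_def)
    have t0: "t > 0" using P1.sigma_pos P2.sigma_pos e D by (simp add: t_def)
    have "t * (\<beta> * C) \<le> t * D" using t0 D by (intro mult_left_mono) auto
    also have "\<dots> \<le> e" using t(4) D by (simp add: field_simps)
    finally show "\<beta> * (\<sigma>1 + \<sigma>2) \<le> 2 * err + e"
      using step[of t] t t0 P1.sigma_pos P2.sigma_pos by (simp add: field_simps)
  qed
  then have "\<beta> \<le> 2 * err / (\<sigma>1 + \<sigma>2)"
    using P1.sigma_pos P2.sigma_pos by (simp add: field_simps)
  then have "\<beta> * (norm x0 * norm z0) \<le> 2 * err / (\<sigma>1 + \<sigma>2) * (norm x0 * norm z0)"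
    by (intro mult_right_mono) auto
  then show ?thesis using \<beta>(2)[OF x0 z0] by linarith
qed

text \<open>Here \<open>Q1 x2 - r\<close> is the Sylvester term, and \<open>Q1 u = Q1 n\<close> and
  \<open>y - r\<close> are the two corner terms. A single \<open>a\<close> serves both:
  \<open>Q1 u\<close> is orthogonal to \<open>y - r\<close> and \<open>n\<close> to
  \<open>x2\<close>, so Pythagoras applies to images and arguments alike.\<close>

lemma onorm_diff_le:
  assumes a: "a \<ge> 0"
    and null: "\<And>x u. A2 x = 0 \<Longrightarrow> u \<in> P1.coimage \<Longrightarrow> A1 (x - u) = 0 \<Longrightarrow> norm u \<le> a * norm x"
    and range: "\<And>y r. y \<in> range A2 \<Longrightarrow> r \<in> range A1 \<Longrightarrow> y - r \<in> (range A1)\<^sup>\<bottom>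
      \<Longrightarrow> norm (y - r) \<le> a * norm y"
  shows "onorm (\<lambda>x. Q1 x - Q2 x) \<le> 2 * err / (\<sigma>1 + \<sigma>2) + a"
proof (rule onorm_bound)
  define K where "K = 2 * err / (\<sigma>1 + \<sigma>2)"
  have K0: "K \<ge> 0" using err_nonneg P1.sigma_pos P2.sigma_pos by (simp add: K_def)
  then show "0 \<le> 2 * err / (\<sigma>1 + \<sigma>2) + a" using a by (simp add: K_def)
  fix x
  obtain x2 where x2: "x2 \<in> P2.coimage" "A2 (x - x2) = 0" by (rule P2.null_decomposition)
  define n where "n = x - x2"
  obtain u where u: "u \<in> P1.coimage" "A1 (n - u) = 0" by (rule P1.null_decomposition)
  define y where "y = Q2 x2"
  have y: "y \<in> range A2" unfolding y_def by (rule P2.Q_in_range)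
  obtain r where r: "r \<in> range A1" "y - r \<in> (range A1)\<^sup>\<bottom>"
    using orthogonal_decomposition[OF P1.subspace_range P1.closed_range] by blast
  have orth: "inner x2 n = 0" using P2.null_orthogonal[of n x2] x2 by (simp add: n_def inner_commute)
  have nx: "(norm x)\<^sup>2 = (norm x2)\<^sup>2 + (norm n)\<^sup>2" using pythagoras[OF orth] by (simp add: n_def)
  have x2x: "norm x2 \<le> norm x" using norm_le_norm_add_orthogonal[OF orth] by (simp add: n_def)
  have Q1n: "Q1 n = Q1 u" using u(2) P1.null_Q[of "n - u"] by (simp add: P1.Q.diff)
  have "Q2 n = 0" using x2(2) P2.null_Q by (simp add: n_def)
  then have eq: "Q1 x - Q2 x = (Q1 x2 - r) + (Q1 u - (y - r))"
    using Q1n by (simp add: y_def n_def P1.Q.diff P2.Q.diff algebra_simps)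
  have w: "Q1 x2 - r \<in> range A1"
    by (intro subspace_diff P1.subspace_range P1.Q_in_range r)
  \<comment> \<open>\<open>z\<close> has the norm of \<open>Q1 x2 - r\<close>, and pairing with
    \<open>Q1 z\<close> turns the squared norm into a value of the form; one factor then
    cancels.\<close>
  obtain z where z: "z \<in> P1.coimage" "Q1 x2 - r = Q1 z" using P1.range_Q_coimage[OF w] .
  have "norm (Q1 x2 - r) * norm (Q1 x2 - r) = inner (Q1 x2 - r) (Q1 z)"
    by (metis z(2) power2_norm_eq_inner power2_eq_square)
  also have "\<dots> = inner (Q1 x2 - y) (Q1 z)"
  proof -
    have "inner (y - r) (Q1 z) = 0"
      using r(2) P1.Q_in_range[of z] unfolding mem_orthogonal_comp_iff' by blast
    then show ?thesis by (simp add: inner_diff_left)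
  qed
  also have "\<dots> = defect x2 z"
    by (simp add: defect_def inner_diff_left P1.inner_Q_coimage z y_def)
  also have "\<dots> \<le> K * (norm x2 * norm z)" unfolding K_def by (rule defect_le[OF x2(1) z(1)])
  also have "norm z = norm (Q1 x2 - r)" using P1.isometric[OF z(1)] z(2) by simp
  finally have "norm (Q1 x2 - r) * norm (Q1 x2 - r) \<le> norm (Q1 x2 - r) * (K * norm x2)"
    by (simp add: mult_ac)
  then have 1: "norm (Q1 x2 - r) \<le> K * norm x2"
    using K0 by (cases "Q1 x2 - r = 0") (auto simp: mult_le_cancel_left)
  have "inner (Q1 u) (y - r) = 0"
    using r(2) P1.Q_in_range[of u] unfolding mem_orthogonal_comp_iff by blast
  then have "inner (Q1 u) (- (y - r)) = 0" by (simp only: inner_minus_right minus_zero)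
  from pythagoras[OF this] have "(norm (Q1 u - (y - r)))\<^sup>2 = (norm u)\<^sup>2 + (norm (y - r))\<^sup>2"
    unfolding norm_minus_cancel P1.isometric[OF u(1)] by (simp only: diff_conv_add_uminus)
  also have "\<dots> \<le> (a * norm n)\<^sup>2 + (a * norm x2)\<^sup>2"
  proof (intro add_mono power_mono norm_ge_zero)
    show "norm u \<le> a * norm n" using null[of n u] x2(2) u by (simp add: n_def)
    show "norm (y - r) \<le> a * norm x2" using range[OF y r] P2.isometric[OF x2(1)] by (simp add: y_def)
  qed
  also have "\<dots> = (a * norm x)\<^sup>2" by (simp add: power_mult_distrib nx algebra_simps)
  finally have 2: "norm (Q1 u - (y - r)) \<le> a * norm x" by (rule power2_le_imp_le) (use a in simp)
  have "norm (Q1 x - Q2 x) \<le> norm (Q1 x2 - r) + norm (Q1 u - (y - r))"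
    unfolding eq by (rule norm_triangle_ineq)
  also have "\<dots> \<le> K * norm x + a * norm x"
    using 1 2 mult_left_mono[OF x2x K0] by linarith
  finally show "norm (Q1 x - Q2 x) \<le> (2 * err / (\<sigma>1 + \<sigma>2) + a) * norm x"
    by (simp add: K_def algebra_simps)
qed

section \<open>The corner terms and the refined estimate\<close>

lemma null_estimate:
  assumes "A2 x = 0" "u \<in> P1.coimage" "A1 (x - u) = 0"
  shows "norm u \<le> err / \<sigma>1 * norm x"
proof -
  have "\<sigma>1 * norm u \<le> norm (A1 u)" by (rule P1.norm_A_ge[OF assms(2)])
  also have "A1 u = A1 x - A2 x" using assms by (simp add: P1.A.diff)
  also have "norm \<dots> \<le> err * norm x" by (rule err_le)
  finally show ?thesis using P1.sigma_pos by (simp add: field_simps)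
qed

text \<open>\<open>r\<close> is the point of \<open>range A1\<close> nearest to
  \<open>y = A2 v\<close>, so it does at least as well as the competitor
  \<open>A1 v\<close>.\<close>

lemma range_estimate:
  assumes y: "y \<in> range A2" and r: "r \<in> range A1" "y - r \<in> (range A1)\<^sup>\<bottom>"
  shows "norm (y - r) \<le> err / \<sigma>2 * norm y"
proof -
  obtain v where v: "v \<in> P2.coimage" "y = A2 v" using P2.range_A_coimage[OF y] .
  have "r - A1 v \<in> range A1" by (intro subspace_diff P1.subspace_range r rangeI)
  then have "inner (y - r) (r - A1 v) = 0" using r(2) unfolding mem_orthogonal_comp_iff' by blast
  from norm_le_norm_add_orthogonal[OF this] have "norm (y - r) \<le> norm (y - A1 v)" by simp
  also have "\<dots> \<le> err * norm v" using err_le[of v] v by (simp add: norm_minus_commute)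
  also have "\<dots> \<le> err * (norm y / \<sigma>2)"
    using P2.norm_A_ge[OF v(1)] P2.sigma_pos err_nonneg v(2)
    by (intro mult_left_mono) (auto simp: field_simps)
  finally show ?thesis by simp
qed

lemma bound_min: "onorm (\<lambda>x. Q1 x - Q2 x) \<le> 2 * err / (\<sigma>1 + \<sigma>2) + err / min \<sigma>1 \<sigma>2"
proof (rule onorm_diff_le)
  have m: "err / \<sigma>1 \<le> err / min \<sigma>1 \<sigma>2" "err / \<sigma>2 \<le> err / min \<sigma>1 \<sigma>2"
    using P1.sigma_pos P2.sigma_pos err_nonneg by (auto intro!: divide_left_mono)
  show "err / min \<sigma>1 \<sigma>2 \<ge> 0" using P1.sigma_pos P2.sigma_pos err_nonneg by simp
  show "norm u \<le> err / min \<sigma>1 \<sigma>2 * norm x"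
    if "A2 x = 0" "u \<in> P1.coimage" "A1 (x - u) = 0" for x u
    using null_estimate[OF that] mult_right_mono[OF m(1) norm_ge_zero[of x]] by linarith
  show "norm (y - r) \<le> err / min \<sigma>1 \<sigma>2 * norm y"
    if "y \<in> range A2" "r \<in> range A1" "y - r \<in> (range A1)\<^sup>\<bottom>" for y r
    using range_estimate[OF that] mult_right_mono[OF m(2) norm_ge_zero[of y]] by linarith
qed

lemma swap: "real_polar_pair A2 Q2 H2 \<sigma>2 A1 Q1 H1 \<sigma>1" ..

lemma err_swap: "real_polar_pair.err A2 A1 = err"
  unfolding err_def real_polar_pair.err_def[OF swap]
  by (subst onorm_neg[symmetric]) simp

text \<open>The kernel term already carries \<open>\<sigma>1\<close>. The range term receives it by
  estimating the gap in the opposite direction and reversing it with \<open>gap_symmetric\<close>.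
  \<open>inj\<close> is restricted to \<open>err < \<sigma>1\<close> because the kernel condition is
  shown to deliver it under that bound.\<close>

lemma bound_first:
  assumes inj: "\<And>y. err < \<sigma>1 \<Longrightarrow> y \<in> range A2 \<Longrightarrow> y \<in> (range A1)\<^sup>\<bottom> \<Longrightarrow> y = 0"
  shows "onorm (\<lambda>x. Q1 x - Q2 x) \<le> 2 * err / (\<sigma>1 + \<sigma>2) + err / \<sigma>1"
proof (rule onorm_diff_le[OF _ null_estimate])
  show "err / \<sigma>1 \<ge> 0" using P1.sigma_pos err_nonneg by simp
  fix y r assume y: "y \<in> range A2" and r: "r \<in> range A1" "y - r \<in> (range A1)\<^sup>\<bottom>"
  show "norm (y - r) \<le> err / \<sigma>1 * norm y"
  proof (cases "err < \<sigma>1")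
    case True
    show ?thesis
    proof (rule gap_symmetric[OF P1.subspace_range P1.closed_range P2.subspace_range P2.closed_range _ _ _ y r])
      show "err / \<sigma>1 < 1" using True P1.sigma_pos by simp
      show "norm (x - y) \<le> err / \<sigma>1 * norm x"
        if "x \<in> range A1" "y \<in> range A2" "x - y \<in> (range A2)\<^sup>\<bottom>" for x y
        using real_polar_pair.range_estimate[OF swap that] by (simp add: err_swap)
      show "y = 0" if "y \<in> range A2" "y \<in> (range A1)\<^sup>\<bottom>" for y
        using inj[OF True that] .
    qed
  next
    case False
    \<comment> \<open>Now \<open>err / \<sigma>1 \<ge> 1\<close>, and the residual of a projection
      is never longer than \<open>y\<close>.\<close>
    have "inner (y - r) r = 0" using r unfolding mem_orthogonal_comp_iff' by blast
    from norm_le_norm_add_orthogonal[OF this] have "norm (y - r) \<le> norm y" by simp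
    also have "\<dots> \<le> err / \<sigma>1 * norm y"
      using mult_right_mono[of 1 "err / \<sigma>1" "norm y"] False P1.sigma_pos by simp
    finally show ?thesis .
  qed
qed

text \<open>\<open>y\<close> is lifted to \<open>z\<close> in \<open>P1.coimage\<close> with
  \<open>A2 z = y\<close>. Since \<open>y\<close> is orthogonal to \<open>A1 z\<close>, the squared
  norm of \<open>A1 z\<close> equals \<open>inner (A1 z) (A1 z - A2 z)\<close>; hence
  \<open>\<sigma>1 * norm z \<le> err * norm z\<close> and \<open>z = 0\<close>.\<close>

lemma range_inj_if_null_gap:
  assumes g: "0 \<le> g" "g < 1"
    and g21: "\<And>v p. A2 v = 0 \<Longrightarrow> A1 p = 0 \<Longrightarrow> v - p \<in> P1.coimage \<Longrightarrow> norm (v - p) \<le> g * norm v"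
    and g12: "\<And>v p. A1 v = 0 \<Longrightarrow> A2 p = 0 \<Longrightarrow> v - p \<in> P2.coimage \<Longrightarrow> norm (v - p) \<le> g * norm v"
    and e: "err < \<sigma>1" and y: "y \<in> range A2" "y \<in> (range A1)\<^sup>\<bottom>"
  shows "y = 0"
proof -
  obtain x where x: "x \<in> P2.coimage" "y = A2 x" using P2.range_A_coimage[OF y(1)] .
  \<comment> \<open>Duality between kernels and coimages: with \<open>P1\<close>, \<open>P2\<close>
    read as projections onto the coimages, \<open>(I - P2) P1\<close> is the adjoint of
    \<open>P1 (I - P2)\<close>, which \<open>g21\<close> bounds.\<close>
  have le: "norm (x - w) \<le> g * norm x"
    if x: "x \<in> P1.coimage" and w: "w \<in> P2.coimage" and xw: "x - w \<in> P2.coimage\<^sup>\<bottom>" for x w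
  proof -
    have n: "A2 (x - w) = 0" using xw unfolding P2.coimage_comp by simp
    obtain p where p: "A1 p = 0" "x - w - p \<in> P1.coimage"
      using orthogonal_decomposition[OF P1.null_space_props, of "x - w"] by auto
    have "norm (x - w) * norm (x - w) = inner (x - w) (x - w)"
      by (metis power2_norm_eq_inner power2_eq_square)
    also have "\<dots> = inner (x - w - p) x"
      using P2.null_orthogonal[OF n w] P1.null_orthogonal[OF p(1) x]
      by (simp add: inner_diff_left inner_diff_right)
    also have "\<dots> \<le> norm (x - w - p) * norm x" by (rule norm_cauchy_schwarz)
    also have "\<dots> \<le> g * norm (x - w) * norm x"
      by (intro mult_right_mono g21[OF n p] norm_ge_zero)
    finally have *: "norm (x - w) * norm (x - w) \<le> norm (x - w) * (g * norm x)"
      by (simp add: mult_ac)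
    show ?thesis
    proof (cases "x - w = 0")
      case True
      then show ?thesis using g by simp
    next
      case False
      then show ?thesis using * by (simp add: mult_le_cancel_left)
    qed
  qed
  have inj: "w = 0" if w: "w \<in> P2.coimage" "w \<in> P1.coimage\<^sup>\<bottom>" for w
  proof -
    \<comment> \<open>\<open>w\<close> lies in the kernel of \<open>A1\<close> and has zero
      projection to the kernel of \<open>A2\<close>.\<close>
    have "norm (w - 0) \<le> g * norm w"
      using w g12[of w 0] unfolding P1.coimage_comp by (simp add: P2.A.zero)
    then have "(1 - g) * norm w \<le> 0" by (simp add: algebra_simps)
    then show ?thesis using g by (simp add: mult_le_0_iff)
  qed
  obtain z where z: "z \<in> P1.coimage" "z - x \<in> P2.coimage\<^sup>\<bottom>"
    using surjective_projection[OF P1.coimage_props P2.coimage_props g(2) le inj x(1)] by blast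
  have "A2 (z - x) = 0" using z(2) unfolding P2.coimage_comp by simp
  then have yz: "y = A2 z" using x(2) by (simp add: P2.A.diff)
  have "norm (A1 z) * norm (A1 z) = inner (A1 z) (A1 z)"
    by (metis power2_norm_eq_inner power2_eq_square)
  also have "\<dots> = inner (A1 z) (A1 z - A2 z)"
    using y(2) unfolding mem_orthogonal_comp_iff yz by (simp add: inner_diff_right)
  also have "\<dots> \<le> norm (A1 z) * norm (A1 z - A2 z)" by (rule norm_cauchy_schwarz)
  also have "\<dots> \<le> norm (A1 z) * (err * norm z)" by (intro mult_left_mono err_le norm_ge_zero)
  finally have "norm (A1 z) \<le> err * norm z"
    using err_nonneg by (cases "A1 z = 0") (auto simp: mult_le_cancel_left)
  then have "(\<sigma>1 - err) * norm z \<le> 0" using P1.norm_A_ge[OF z(1)] by (simp add: algebra_simps)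
  then have "z = 0" using e by (simp add: mult_le_0_iff)
  then show "y = 0" by (simp add: yz P2.A.zero)
qed

end

section \<open>Square roots of positive operators\<close>

lemma nonneg_quadratic_discriminant:
  fixes a b c :: real
  assumes "\<And>t. 0 \<le> a + 2 * t * b + t\<^sup>2 * c" "c \<ge> 0"
  shows "b\<^sup>2 \<le> a * c"
proof (cases "c = 0")
  case True
  have "b = 0"
  proof (rule ccontr)
    assume "b \<noteq> 0"
    \<comment> \<open>At this \<open>t\<close> the expression \<open>a + 2 * t * b\<close> equals
      \<open>-1\<close>.\<close>
    then show False using assms(1)[of "- (a + 1) / (2 * b)"] True by (simp add: field_simps)
  qed
  then show ?thesis using True by simp
next
  case False
  have "0 \<le> a + 2 * (- b / c) * b + (- b / c)\<^sup>2 * c" by (rule assms(1))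
  also have "\<dots> = (a * c - b\<^sup>2) / c" using False by (simp add: field_simps power2_eq_square)
  finally show ?thesis using False assms(2) by (simp add: zero_le_divide_iff)
qed

text \<open>Nonnegativity is asked on a subspace because the result is later applied to
  \<open>H - \<mu>\<close>, which is nonnegative on the complement of the kernel.\<close>

lemma nonneg_form_cauchy_schwarz:
  fixes T :: "'a::real_inner \<Rightarrow> 'a"
  assumes "linear T" "subspace M" "x \<in> M" "y \<in> M"
    and "\<And>x y. inner (T x) y = inner x (T y)"
    and nonneg: "\<And>x. x \<in> M \<Longrightarrow> 0 \<le> inner (T x) x"
  shows "(inner (T x) y)\<^sup>2 \<le> inner (T x) x * inner (T y) y"
proof (rule nonneg_quadratic_discriminant)
  fix t :: real
  have "x + t *\<^sub>R y \<in> M" using assms(2-4) by (simp add: subspace_add subspace_scale)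
  then have "0 \<le> inner (T (x + t *\<^sub>R y)) (x + t *\<^sub>R y)" by (rule nonneg)
  also have "inner (T y) x = inner (T x) y" by (metis assms(5) inner_commute)
  then have "inner (T (x + t *\<^sub>R y)) (x + t *\<^sub>R y)
      = inner (T x) x + 2 * t * inner (T x) y + t\<^sup>2 * inner (T y) y"
    using assms(1) by (simp add: linear_add linear_scale inner_add_left inner_add_right
        power2_eq_square algebra_simps)
  finally show "0 \<le> inner (T x) x + 2 * t * inner (T x) y + t\<^sup>2 * inner (T y) y" .
qed (use assms in auto)

text \<open>Cauchy-Schwarz for the form at \<open>x\<close> and \<open>T x\<close>, after cancelling
  the squared norm of \<open>T x\<close>.\<close>

lemma nonneg_form_norm_le:
  fixes T :: "'a::real_inner \<Rightarrow> 'a"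
  assumes "linear T" "subspace M" "x \<in> M" "T x \<in> M"
    and "\<And>x y. inner (T x) y = inner x (T y)"
    and "\<And>x. x \<in> M \<Longrightarrow> 0 \<le> inner (T x) x"
    and "\<And>x. x \<in> M \<Longrightarrow> inner (T x) x \<le> k * (norm x)\<^sup>2"
  shows "(norm (T x))\<^sup>2 \<le> k * inner (T x) x"
proof (cases "T x = 0")
  case False
  have "((norm (T x))\<^sup>2)\<^sup>2 \<le> inner (T x) x * inner (T (T x)) (T x)"
    using nonneg_form_cauchy_schwarz[OF assms(1-6)] by (simp add: power2_norm_eq_inner)
  also have "\<dots> \<le> inner (T x) x * (k * (norm (T x))\<^sup>2)"
    by (intro mult_left_mono assms)
  finally have "(norm (T x))\<^sup>2 * (norm (T x))\<^sup>2 \<le> (norm (T x))\<^sup>2 * (k * inner (T x) x)"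
    by (simp only: power2_eq_square mult_ac)
  moreover have "(norm (T x))\<^sup>2 > 0" using False by simp
  ultimately show ?thesis by (rule mult_left_le_imp_le)
qed simp

text \<open>Over the reals a nonnegative form does not force symmetry, so symmetry is a separate
  requirement.\<close>

locale positive_operator =
  fixes T :: "'a::{real_inner,banach} \<Rightarrow> 'a"
  assumes bounded_linear: "bounded_linear T"
    and symmetric: "inner (T x) y = inner x (T y)"
    and nonneg: "0 \<le> inner (T x) x"
begin

sublocale bounded_linear T by (rule bounded_linear)

lemma form_le: "inner (T x) x \<le> onorm T * (norm x)\<^sup>2"
proof -
  have "inner (T x) x \<le> norm (T x) * norm x" by (rule norm_cauchy_schwarz)
  also have "\<dots> \<le> onorm T * norm x * norm x"
    by (intro mult_right_mono onorm bounded_linear norm_ge_zero)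
  finally show ?thesis by (simp add: power2_eq_square mult_ac)
qed

lemma norm_sq_le: "(norm (T x))\<^sup>2 \<le> onorm T * inner (T x) x"
  using nonneg_form_norm_le[OF linear_axioms subspace_UNIV UNIV_I UNIV_I symmetric nonneg form_le] .

lemma positive_scaled:
  assumes "k \<ge> 0"
  shows "positive_operator (\<lambda>x. k *\<^sub>R T x)"
proof (rule positive_operator.intro)
  show "bounded_linear (\<lambda>x. k *\<^sub>R T x)"
    by (rule bounded_linear_compose[OF bounded_linear_scaleR_right bounded_linear])
  show "inner (k *\<^sub>R T x) y = inner x (k *\<^sub>R T y)" for x y by (simp add: symmetric)
  show "0 \<le> inner (k *\<^sub>R T x) x" for x using assms nonneg[of x] by simp
qed

lemma form_eq_0: "inner (T x) x = 0 \<Longrightarrow> T x = 0"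
  using norm_sq_le[of x] by simp

end


section \<open>Iterative construction of the positive square root\<close>

text \<open>The iterates \<open>X \<mapsto> (B + X\<^sup>2) / 2\<close> with \<open>B = I - T\<close> are dominated by the scalar iteration
  \<open>r \<mapsto> (1 + r\<^sup>2) / 2\<close>; a limit \<open>X\<close> satisfies \<open>(I - X)\<^sup>2 = I - B = T\<close>.\<close>

primrec sqrt_iter :: "('a \<Rightarrow> 'a::real_vector) \<Rightarrow> nat \<Rightarrow> 'a \<Rightarrow> 'a" where
  "sqrt_iter B 0 x = 0"
| "sqrt_iter B (Suc n) x = (1/2) *\<^sub>R (B x + sqrt_iter B n (sqrt_iter B n x))"

primrec sqrt_iter_bound :: "nat \<Rightarrow> real" where
  "sqrt_iter_bound 0 = 0"
| "sqrt_iter_bound (Suc n) = (1 + (sqrt_iter_bound n)\<^sup>2) / 2"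

lemma sqrt_iter_bound_range: "0 \<le> sqrt_iter_bound n \<and> sqrt_iter_bound n \<le> 1"
  by (induction n) (auto simp: power_le_one)

lemma sqrt_iter_bound_mono: "sqrt_iter_bound n \<le> sqrt_iter_bound (Suc n)"
proof -
  have "0 \<le> (1 - sqrt_iter_bound n)\<^sup>2" by simp
  then show ?thesis by (simp add: power2_eq_square algebra_simps)
qed

lemma sqrt_iter_linear:
  assumes "linear B"
  shows "linear (sqrt_iter B n)"
proof (induction n)
  case 0
  show ?case by (auto intro: linearI)
next
  case (Suc n)
  then show ?case
    using assms by (auto intro!: linearI simp: linear_add linear_scale algebra_simps)
qed

lemma sqrt_iter_norm:
  fixes B :: "'a::real_normed_vector \<Rightarrow> 'a"
  assumes "\<And>x. norm (B x) \<le> norm x"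
  shows "norm (sqrt_iter B n x) \<le> sqrt_iter_bound n * norm x"
proof (induction n arbitrary: x)
  case (Suc n)
  have "norm (sqrt_iter B n (sqrt_iter B n x)) \<le> sqrt_iter_bound n * norm (sqrt_iter B n x)"
    by (rule Suc)
  also have "\<dots> \<le> sqrt_iter_bound n * (sqrt_iter_bound n * norm x)"
    using sqrt_iter_bound_range by (intro mult_left_mono Suc) auto
  finally have "norm (B x + sqrt_iter B n (sqrt_iter B n x))
      \<le> norm x + sqrt_iter_bound n * (sqrt_iter_bound n * norm x)"
    using assms[of x] norm_triangle_ineq[of "B x" "sqrt_iter B n (sqrt_iter B n x)"] by linarith
  then show ?case by (simp add: power2_eq_square algebra_simps del: scaleR_add_right)
qed simp

lemma sqrt_iter_diff:
  fixes B :: "'a::real_normed_vector \<Rightarrow> 'a"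
  assumes "linear B" "\<And>x. norm (B x) \<le> norm x"
  shows "norm (sqrt_iter B (Suc n) x - sqrt_iter B n x)
    \<le> (sqrt_iter_bound (Suc n) - sqrt_iter_bound n) * norm x"
proof (induction n arbitrary: x)
  case 0
  show ?case using assms(2)[of x] by simp
next
  case (Suc n)
  let ?X = "sqrt_iter B" and ?r = sqrt_iter_bound
  let ?d = "?r (Suc n) - ?r n"
  note d = sqrt_iter_bound_mono[of n]
  have "?X (Suc n) (?X (Suc n) x - ?X n x) = ?X (Suc n) (?X (Suc n) x) - ?X (Suc n) (?X n x)"
    by (rule linear_diff[OF sqrt_iter_linear[OF assms(1)]])
  \<comment> \<open>A difference of squares in the form
    \<open>Y Y - X X = Y (Y - X) + (Y - X) X\<close>, so that the induction hypothesis applies to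
    each summand.\<close>
  then have eq: "?X (Suc (Suc n)) x - ?X (Suc n) x
      = (1/2) *\<^sub>R (?X (Suc n) (?X (Suc n) x - ?X n x) + (?X (Suc n) (?X n x) - ?X n (?X n x)))"
    unfolding sqrt_iter.simps(2)[of B "Suc n"] sqrt_iter.simps(2)[of B n x]
    by (simp only: scaleR_right_diff_distrib[symmetric]) (simp del: sqrt_iter.simps)
  have "norm (?X (Suc n) (?X (Suc n) x - ?X n x)) \<le> ?r (Suc n) * norm (?X (Suc n) x - ?X n x)"
    by (rule sqrt_iter_norm[OF assms(2)])
  also have "\<dots> \<le> ?r (Suc n) * (?d * norm x)"
    using sqrt_iter_bound_range[of "Suc n"] by (intro mult_left_mono Suc) auto
  finally have 1: "norm (?X (Suc n) (?X (Suc n) x - ?X n x)) \<le> ?r (Suc n) * (?d * norm x)" .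
  have "norm (?X (Suc n) (?X n x) - ?X n (?X n x)) \<le> ?d * norm (?X n x)" by (rule Suc)
  also have "\<dots> \<le> ?d * (?r n * norm x)"
    using d by (intro mult_left_mono sqrt_iter_norm assms) auto
  finally have 2: "norm (?X (Suc n) (?X n x) - ?X n (?X n x)) \<le> ?d * (?r n * norm x)" .
  have "norm (?X (Suc (Suc n)) x - ?X (Suc n) x)
      \<le> 1/2 * (?r (Suc n) * (?d * norm x) + ?d * (?r n * norm x))"
    unfolding eq using norm_triangle_le[OF add_mono[OF 1 2]] by (simp del: sqrt_iter.simps)
  also have "\<dots> = ((1 + (?r (Suc n))\<^sup>2) / 2 - (1 + (?r n)\<^sup>2) / 2) * norm x"
    by (simp only: power2_eq_square) (simp add: algebra_simps diff_divide_distrib add_divide_distrib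
        del: sqrt_iter_bound.simps)
  finally show ?case by (simp only: sqrt_iter_bound.simps(2))
qed

lemma sqrt_iter_convergent:
  fixes B :: "'a::banach \<Rightarrow> 'a"
  assumes "linear B" "\<And>x. norm (B x) \<le> norm x"
  shows "convergent (\<lambda>n. sqrt_iter B n x)"
proof -
  let ?X = "sqrt_iter B" and ?r = sqrt_iter_bound
  have "summable (\<lambda>n. ?X (Suc n) x - ?X n x)"
  proof (rule summable_comparison_test[OF exI[of _ 0]])
    show "\<forall>n\<ge>0. norm (?X (Suc n) x - ?X n x) \<le> (?r (Suc n) - ?r n) * norm x"
      using sqrt_iter_diff[OF assms] by blast
    have "Bseq ?r" using sqrt_iter_bound_range by (intro BseqI'[of _ 1]) auto
    then have "convergent ?r"
      using sqrt_iter_bound_mono by (intro Bseq_monoseq_convergent mono_SucI1[OF allI])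
    then obtain l where "?r \<longlonglongrightarrow> l" by (auto simp: convergent_def)
    then have "summable (\<lambda>n. ?r (Suc n) - ?r n)" by (rule telescope_summable)
    then show "summable (\<lambda>n. (?r (Suc n) - ?r n) * norm x)" by (rule summable_mult2)
  qed
  then have "convergent (\<lambda>n. \<Sum>i<n. ?X (Suc i) x - ?X i x)"
    by (simp only: summable_iff_convergent)
  moreover have "(\<Sum>i<n. ?X (Suc i) x - ?X i x) = ?X n x" for n
    using sum_lessThan_telescope[of "\<lambda>i. ?X i x"] by (simp del: sqrt_iter.simps(2))
  ultimately show ?thesis by simp
qed

text \<open>The commutation property passes from \<open>T\<close> to each iterate and to the limit.
  It later yields uniqueness of the root and its complex linearity.\<close>

lemma positive_contraction_sqrt:
  fixes T :: "'a::{real_inner,banach} \<Rightarrow> 'a"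
  assumes "positive_operator T" "\<And>x. inner (T x) x \<le> (norm x)\<^sup>2"
  obtains S where "positive_operator S" "\<And>x. S (S x) = T x"
    "\<And>C x. bounded_linear C \<Longrightarrow> (\<And>x. C (T x) = T (C x)) \<Longrightarrow> C (S x) = S (C x)"
proof -
  interpret T: positive_operator T by fact
  define B where "B x = x - T x" for x
  have linB: "linear B" by (auto intro!: linearI simp: B_def T.add T.scale algebra_simps)
  have symB: "inner (B x) y = inner x (B y)" for x y
    by (simp add: B_def inner_diff_left inner_diff_right T.symmetric)
  have nB: "norm (B x) \<le> norm x" for x
  proof -
    have "(norm (B x))\<^sup>2 \<le> 1 * inner (B x) x"
      using assms(2) T.nonneg
      by (intro nonneg_form_norm_le[OF linB subspace_UNIV UNIV_I UNIV_I symB])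
        (auto simp: B_def inner_diff_left power2_norm_eq_inner)
    also have "\<dots> \<le> (norm x)\<^sup>2" using T.nonneg by (simp add: B_def inner_diff_left power2_norm_eq_inner)
    finally show ?thesis by (rule power2_le_imp_le) simp
  qed
  let ?X = "sqrt_iter B"
  define L where "L x = lim (\<lambda>n. ?X n x)" for x
  have L: "(\<lambda>n. ?X n x) \<longlonglongrightarrow> L x" for x
    unfolding L_def using sqrt_iter_convergent[OF linB nB] by (simp add: convergent_LIMSEQ_iff)
  have nX: "norm (?X n x) \<le> norm x" for n x
    using order_trans[OF sqrt_iter_norm[OF nB] mult_right_mono[of _ 1]] sqrt_iter_bound_range[of n]
    by fastforce
  have symX: "inner (?X n x) y = inner x (?X n y)" for n x y
    by (induction n arbitrary: x y) (simp_all add: inner_add_left inner_add_right symB)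
  have nL: "norm (L x) \<le> norm x" for x
    using LIMSEQ_le_const2[OF tendsto_norm[OF L]] nX by blast
  have addL: "L (x + y) = L x + L y" for x y
    using LIMSEQ_unique[OF L[of "x + y"]] tendsto_add[OF L L, of x y]
    by (simp add: linear_add[OF sqrt_iter_linear[OF linB]])
  have scaleL: "L (r *\<^sub>R x) = r *\<^sub>R L x" for r x
    using LIMSEQ_unique[OF L[of "r *\<^sub>R x"]] tendsto_scaleR[OF tendsto_const L, of r x]
    by (simp add: linear_scale[OF sqrt_iter_linear[OF linB]])
  have blL: "bounded_linear L"
    by (rule bounded_linear_intro[of _ 1]) (simp_all add: addL scaleL nL)
  have symL: "inner (L x) y = inner x (L y)" for x y
    using LIMSEQ_unique[OF tendsto_inner[OF L[of x] tendsto_const[of y]]]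
      tendsto_inner[OF tendsto_const[of x] L[of y]] by (simp add: symX)
  have XX: "(\<lambda>n. ?X n (?X n x)) \<longlonglongrightarrow> L (L x)" for x
  proof -
    \<comment> \<open>The outer iterates are contractions, so the inner iterate may be replaced by
      its limit.\<close>
    have "(\<lambda>n. ?X n (?X n x - L x)) \<longlonglongrightarrow> 0"
      by (rule Lim_null_comparison[of _ "\<lambda>n. norm (?X n x - L x)"])
        (use nX L in \<open>auto simp: LIM_zero_iff tendsto_norm_zero\<close>)
    then have "(\<lambda>n. ?X n (?X n x - L x) + ?X n (L x)) \<longlonglongrightarrow> 0 + L (L x)"
      by (intro tendsto_add L)
    then show ?thesis by (simp add: linear_diff[OF sqrt_iter_linear[OF linB]])
  qed
  have L_fix: "L x = (1/2) *\<^sub>R (B x + L (L x))" for x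
  proof (rule LIMSEQ_unique[OF LIMSEQ_Suc[OF L]])
    show "(\<lambda>n. ?X (Suc n) x) \<longlonglongrightarrow> (1/2) *\<^sub>R (B x + L (L x))"
      unfolding sqrt_iter.simps(2) by (intro tendsto_intros XX)
  qed
  define S where "S x = x - L x" for x
  have "positive_operator S"
  proof (rule positive_operator.intro)
    show "bounded_linear S" unfolding S_def by (intro bounded_linear_intros blL)
    show "inner (S x) y = inner x (S y)" for x y
      by (simp add: S_def inner_diff_left inner_diff_right symL)
    show "0 \<le> inner (S x) x" for x
    proof -
      have "inner (L x) x \<le> norm (L x) * norm x" by (rule norm_cauchy_schwarz)
      also have "\<dots> \<le> norm x * norm x" by (intro mult_right_mono nL) simp
      finally show ?thesis
        by (simp add: S_def inner_diff_left flip: power2_norm_eq_inner power2_eq_square)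
    qed
  qed
  moreover have "S (S x) = T x" for x
  proof -
    have "2 *\<^sub>R L x = B x + L (L x)" using arg_cong[OF L_fix[of x], of "\<lambda>v. 2 *\<^sub>R v"] by simp
    then have "L (L x) = L x + L x - x + T x" by (simp add: B_def scaleR_2 algebra_simps)
    moreover have "L (x - L x) = L x - L (L x)" by (rule linear_diff[OF bounded_linear.linear[OF blL]])
    ultimately show ?thesis by (simp add: S_def)
  qed
  moreover have "C (S x) = S (C x)" if C: "bounded_linear C" "\<And>x. C (T x) = T (C x)" for C x
  proof -
    interpret C: bounded_linear C by fact
    have "C (?X n x) = ?X n (C x)" for n x
      by (induction n arbitrary: x) (simp_all add: C.zero C.scale C.add C.diff B_def C(2))
    then have "C (L x) = L (C x)"
      using LIMSEQ_unique[OF C.tendsto[OF L[of x]]] L[of "C x"] by simp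
    then show ?thesis by (simp add: S_def C.diff)
  qed
  ultimately show ?thesis using that by blast
qed

lemma positive_sqrt:
  fixes T :: "'a::{real_inner,banach} \<Rightarrow> 'a"
  assumes "positive_operator T"
  obtains S where "positive_operator S" "\<And>x. S (S x) = T x"
    "\<And>C x. bounded_linear C \<Longrightarrow> (\<And>x. C (T x) = T (C x)) \<Longrightarrow> C (S x) = S (C x)"
proof -
  interpret T: positive_operator T by fact
  \<comment> \<open>Rescaling reduces to the contraction case; the summand 1 keeps \<open>k\<close>
    positive for \<open>T = 0\<close>.\<close>
  define k where "k = onorm T + 1"
  have k: "k > 0" using onorm_pos_le[OF T.bounded_linear] by (simp add: k_def)
  have "positive_operator (\<lambda>x. (1 / k) *\<^sub>R T x)"
    by (rule T.positive_scaled) (use k in simp)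
  moreover have "inner ((1 / k) *\<^sub>R T x) x \<le> (norm x)\<^sup>2" for x
  proof -
    have "inner (T x) x \<le> k * (norm x)\<^sup>2" using T.form_le[of x] zero_le_power2[of "norm x"] unfolding k_def distrib_right by linarith
    then show ?thesis using k by (simp add: field_simps)
  qed
  ultimately obtain R where R: "positive_operator R" "\<And>x. R (R x) = (1 / k) *\<^sub>R T x"
    "\<And>C x. bounded_linear C \<Longrightarrow> (\<And>x. C ((1 / k) *\<^sub>R T x) = (1 / k) *\<^sub>R T (C x)) \<Longrightarrow> C (R x) = R (C x)"
    by (rule positive_contraction_sqrt) blast
  interpret R: positive_operator R by fact
  have "positive_operator (\<lambda>x. sqrt k *\<^sub>R R x)"
    by (rule R.positive_scaled) (use k in simp)
  moreover have "sqrt k *\<^sub>R R (sqrt k *\<^sub>R R x) = T x" for x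
    using k by (simp add: R.scale R(2))
  moreover have "C (sqrt k *\<^sub>R R x) = sqrt k *\<^sub>R R (C x)"
    if C: "bounded_linear C" "\<And>x. C (T x) = T (C x)" for C x
  proof -
    interpret C: bounded_linear C by fact
    show ?thesis using R(3)[OF C(1)] by (simp add: C.scale C(2))
  qed
  ultimately show ?thesis using that by blast
qed

text \<open>For \<open>y = P x - S x\<close> commutation gives \<open>P y + S y = 0\<close>, so both
  nonnegative forms vanish at \<open>y\<close> and \<open>P y = S y = 0\<close>. By symmetry
  \<open>inner y y = inner x (P y - S y) = 0\<close>.\<close>

lemma positive_sqrt_unique:
  fixes P S :: "'a::{real_inner,banach} \<Rightarrow> 'a"
  assumes "positive_operator P" "positive_operator S"
    and eq: "\<And>x. P (P x) = S (S x)" and comm: "\<And>x. P (S x) = S (P x)"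
  shows "P x = S x"
proof -
  interpret P: positive_operator P by fact
  interpret S: positive_operator S by fact
  define y where "y = P x - S x"
  have "P y + S y = 0" by (simp add: y_def P.diff S.diff eq comm)
  then have "inner (P y) y + inner (S y) y = 0" by (metis inner_add_left inner_zero_left)
  then have "inner (P y) y = 0" "inner (S y) y = 0" using P.nonneg[of y] S.nonneg[of y] by linarith+
  then have "P y = 0" "S y = 0" using P.form_eq_0 S.form_eq_0 by auto
  then have "inner y y = 0"
    by (metis P.symmetric S.symmetric diff_self inner_diff_left inner_zero_right y_def)
  then show ?thesis by (simp add: y_def)
qed

section \<open>Complex Hilbert spaces, adjoints and absolute values\<close>

lemma cinner_scaleC_right: "cinner x (c *\<^sub>C y) = cnj c * cinner x y"
  by (metis cinner_commute cinner_scaleC_left complex_cnj_mult)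

lemma inner_scaleC_left: "inner (c *\<^sub>C x) y = inner x (cnj c *\<^sub>C y)"
  by (simp add: inner_eq_Re_cinner cinner_scaleC_left cinner_scaleC_right)

lemma scaleC_ii_ii: "\<i> *\<^sub>C \<i> *\<^sub>C x = - x" for x :: "'a::complex_inner"
  using scaleC_of_real[of "-1" x] by (simp add: scaleC_scaleC)

lemma scaleC_minus_left: "(- c) *\<^sub>C x = - (c *\<^sub>C x)" for x :: "'a::complex_inner"
  using scaleC_of_real[of "-1" "c *\<^sub>C x"] by (simp add: scaleC_scaleC)

lemma scaleC_scaleR: "c *\<^sub>C (r *\<^sub>R x) = r *\<^sub>R (c *\<^sub>C x)" for x :: "'a::complex_inner"
  by (simp add: scaleC_of_real[symmetric] scaleC_scaleC mult.commute)

lemma norm_scaleC: "norm (c *\<^sub>C x) = cmod c * norm x" for x :: "'a::complex_inner"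
proof -
  have "(norm (c *\<^sub>C x))\<^sup>2 = inner x (cnj c *\<^sub>C c *\<^sub>C x)"
    by (simp only: power2_norm_eq_inner inner_scaleC_left)
  also have "cnj c *\<^sub>C c *\<^sub>C x = (cmod c)\<^sup>2 *\<^sub>R x"
    by (metis complex_norm_square mult.commute of_real_power scaleC_of_real scaleC_scaleC)
  also have "inner x ((cmod c)\<^sup>2 *\<^sub>R x) = (cmod c * norm x)\<^sup>2"
    by (simp add: power_mult_distrib power2_norm_eq_inner)
  finally show ?thesis by (simp add: power2_eq_iff_nonneg)
qed

lemma bounded_linear_scaleC: "bounded_linear (\<lambda>x::'a::complex_inner. c *\<^sub>C x)"
  by (rule bounded_linear_intro[of _ "cmod c"])
    (simp_all add: scaleC_add_right scaleC_scaleR norm_scaleC)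

lemma inner_scaleC_self: "inner (c *\<^sub>C x) x = Re c * (norm x)\<^sup>2" for x :: "'a::complex_inner"
  by (simp add: inner_eq_Re_cinner cinner_scaleC_left cinner_self)

lemma Im_cinner: "Im (cinner x y) = - inner (\<i> *\<^sub>C x) y"
  by (simp add: inner_eq_Re_cinner cinner_scaleC_left)

lemma cinner_eqI:
  assumes "\<And>c. inner (c *\<^sub>C x) y = inner (c *\<^sub>C u) v"
  shows "cinner x y = cinner u v"
proof (rule complex_eqI)
  show "Im (cinner x y) = Im (cinner u v)" using assms[of \<i>] by (simp add: Im_cinner)
  show "Re (cinner x y) = Re (cinner u v)"
    using assms[of 1] by (simp add: inner_eq_Re_cinner cinner_scaleC_left)
qed

lemma bounded_clinear_bounded_linear: "bounded_clinear A \<Longrightarrow> bounded_linear A"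
  and bounded_clinear_scaleC: "bounded_clinear A \<Longrightarrow> A (c *\<^sub>C x) = c *\<^sub>C A x"
  by (simp_all add: bounded_clinear_def)

text \<open>The imaginary part of \<open>cinner x y\<close> is a real inner product with a rotated
  copy of \<open>y\<close>, which again lies in \<open>S\<close>.\<close>

lemma orth_compl_eq_orthogonal_comp:
  assumes "\<And>c x. x \<in> S \<Longrightarrow> c *\<^sub>C x \<in> S"
  shows "orth_compl S = S\<^sup>\<bottom>"
proof (intro equalityI subsetI)
  fix x assume "x \<in> orth_compl S"
  then show "x \<in> S\<^sup>\<bottom>" by (simp add: orth_compl_def mem_orthogonal_comp_iff' inner_eq_Re_cinner)
next
  fix x assume x: "x \<in> S\<^sup>\<bottom>"
  have "cinner x y = 0" if y: "y \<in> S" for y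
  proof (rule complex_eqI)
    show "Re (cinner x y) = Re 0"
      using x y by (simp add: mem_orthogonal_comp_iff' flip: inner_eq_Re_cinner)
    have "inner x (cnj \<i> *\<^sub>C y) = 0" using x assms[OF y] by (simp add: mem_orthogonal_comp_iff')
    then show "Im (cinner x y) = Im 0" by (simp add: Im_cinner inner_scaleC_left)
  qed
  then show "x \<in> orth_compl S" by (simp add: orth_compl_def)
qed

lemma null_space_scaleC: "bounded_clinear A \<Longrightarrow> x \<in> null_space A \<Longrightarrow> c *\<^sub>C x \<in> null_space A"
  by (simp add: null_space_def bounded_clinear_scaleC linear_0[OF bounded_linear.linear[OF bounded_linear_scaleC]])

lemma range_scaleC: "bounded_clinear A \<Longrightarrow> x \<in> range A \<Longrightarrow> c *\<^sub>C x \<in> range A"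
  by (metis bounded_clinear_scaleC imageE rangeI)

lemma positive_op_iff:
  "positive_op P \<longleftrightarrow> bounded_clinear P \<and> positive_operator P"
proof
  assume P: "positive_op P"
  then have cl: "bounded_clinear P" by (simp add: positive_op_def)
  interpret bounded_linear P by (rule bounded_clinear_bounded_linear[OF cl])
  \<comment> \<open>The complex form being real means that the form of \<open>\<i> P\<close>
    vanishes on the diagonal; polarization at \<open>x\<close> and \<open>\<i> *\<^sub>C y\<close>
    turns this into symmetry of \<open>P\<close>.\<close>
  have real: "inner (\<i> *\<^sub>C P x) x = 0" for x
    using P Im_cinner[of "P x" x] by (simp add: positive_op_def complex_nonneg_Reals_iff)
  have polar: "inner (\<i> *\<^sub>C P x) y + inner (\<i> *\<^sub>C P y) x = 0" for x y
    using real[of "x + y"] real[of x] real[of y]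
    by (simp add: add scaleC_add_right inner_add_left inner_add_right)
  have iso: "inner (\<i> *\<^sub>C u) (\<i> *\<^sub>C v) = inner u v" for u v :: 'a
    using inner_scaleC_left[of \<i> u "\<i> *\<^sub>C v"] scaleC_of_real[of 1 v] by (simp add: scaleC_scaleC)
  have "positive_operator P"
  proof (rule positive_operator.intro[OF bounded_clinear_bounded_linear[OF cl]])
    show "inner (P x) y = inner x (P y)" for x y
      using polar[of x "\<i> *\<^sub>C y"]
      by (simp add: iso bounded_clinear_scaleC[OF cl] scaleC_ii_ii inner_commute)
    show "0 \<le> inner (P x) x" for x
      using P by (simp add: positive_op_def inner_eq_Re_cinner complex_nonneg_Reals_iff)
  qed
  then show "bounded_clinear P \<and> positive_operator P" using cl by blast
next
  assume P: "bounded_clinear P \<and> positive_operator P"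
  then interpret positive_operator P by blast
  have "inner (\<i> *\<^sub>C P x) x = 0" for x
  proof -
    have "inner (\<i> *\<^sub>C P x) x = inner (P x) (\<i> *\<^sub>C x)"
      using P symmetric[of "\<i> *\<^sub>C x" x] by (simp add: bounded_clinear_scaleC inner_commute)
    moreover have "inner (\<i> *\<^sub>C P x) x = - inner (P x) (\<i> *\<^sub>C x)"
      by (simp add: inner_scaleC_left scaleC_minus_left)
    ultimately show ?thesis by simp
  qed
  then show "positive_op P"
    using P nonneg by (simp add: positive_op_def complex_nonneg_Reals_iff Im_cinner flip: inner_eq_Re_cinner)
qed

section \<open>Adjoints and absolute values\<close>

lemma cadjoint_props:
  assumes "bounded_clinear A"
  shows "bounded_clinear (cadjoint A)" "cinner (A x) y = cinner x (cadjoint A y)"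
proof -
  obtain B where B: "bounded_linear B" "\<And>x y. inner (A x) y = inner x (B y)"
    using adjoint_exists[OF bounded_clinear_bounded_linear[OF assms]] by blast
  \<comment> \<open>Complex linearity moves scalars inside \<open>A\<close>, so the real identity at
    all \<open>c *\<^sub>C x\<close> is the complex one.\<close>
  have adj: "cinner (A x) y = cinner x (B y)" for x y
    by (rule cinner_eqI) (simp add: B(2)[symmetric] bounded_clinear_scaleC[OF assms])
  have "B (c *\<^sub>C y) = c *\<^sub>C B y" for c y
  proof -
    have "inner u (B (c *\<^sub>C y)) = inner u (c *\<^sub>C B y)" for u
      by (simp add: inner_eq_Re_cinner cinner_scaleC_right flip: adj)
    then have "inner u (B (c *\<^sub>C y) - c *\<^sub>C B y) = 0" for u by (simp add: inner_diff_right)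
    then show ?thesis by (metis inner_eq_zero_iff right_minus_eq)
  qed
  then have cl: "bounded_clinear B" using B by (simp add: bounded_clinear_def)
  have "cadjoint A = B" unfolding cadjoint_def
  proof (rule the_equality)
    show "bounded_clinear B \<and> (\<forall>x y. cinner (A x) y = cinner x (B y))" using cl adj by blast
    fix B' assume B': "bounded_clinear B' \<and> (\<forall>x y. cinner (A x) y = cinner x (B' y))"
    have "inner u (B' y) = inner u (B y)" for u y
      unfolding inner_eq_Re_cinner using B' adj by metis
    then have "inner u (B' y - B y) = 0" for u y by (simp add: inner_diff_right)
    then show "B' = B" by (metis inner_eq_zero_iff right_minus_eq ext)
  qed
  then show "bounded_clinear (cadjoint A)" "cinner (A x) y = cinner x (cadjoint A y)"
    using cl adj by simp_all
qed

lemma sqrt_op_props: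
  assumes "bounded_clinear T" "positive_operator T"
  shows "positive_op (sqrt_op T)" "sqrt_op T \<circ> sqrt_op T = T"
proof -
  obtain S where S: "positive_operator S" "\<And>x. S (S x) = T x"
    "\<And>C x. bounded_linear C \<Longrightarrow> (\<And>x. C (T x) = T (C x)) \<Longrightarrow> C (S x) = S (C x)"
    using positive_sqrt[OF assms(2)] by blast
  \<comment> \<open>Multiplication by \<open>c\<close> commutes with \<open>T\<close>, hence with
    the root \<open>S\<close>.\<close>
  have "c *\<^sub>C S x = S (c *\<^sub>C x)" for c x
    by (rule S(3)[OF bounded_linear_scaleC]) (simp add: bounded_clinear_scaleC[OF assms(1)])
  then have S': "positive_op S \<and> S \<circ> S = T"
    using S by (auto simp: positive_op_iff bounded_clinear_def positive_operator_def)
  have "sqrt_op T = S" unfolding sqrt_op_def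
  proof (rule the_equality)
    show "positive_op S \<and> S \<circ> S = T" by (rule S')
    fix P assume P: "positive_op P \<and> P \<circ> P = T"
    then have pP: "positive_operator P" and PP: "\<And>x. P (P x) = T x" by (auto simp: positive_op_iff)
    \<comment> \<open>Any \<open>P\<close> with \<open>P \<circ> P = T\<close> commutes with
      \<open>T\<close>, and therefore with \<open>S\<close>.\<close>
    have comm: "P (S x) = S (P x)" for x
      by (rule S(3)) (simp_all add: positive_operator.bounded_linear[OF pP] flip: PP)
    show "P = S"
      by (rule ext, rule positive_sqrt_unique[OF pP S(1) _ comm]) (simp only: PP S(2))
  qed
  then show "positive_op (sqrt_op T)" "sqrt_op T \<circ> sqrt_op T = T" using S' by simp_all
qed

lemma abs_op_props:
  assumes A: "bounded_clinear A"
  shows "bounded_clinear (abs_op A)" "positive_operator (abs_op A)" "norm (abs_op A x) = norm (A x)"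
proof -
  define T where "T = cadjoint A \<circ> A"
  note adj = cadjoint_props[OF A]
  have inner: "inner (A x) (A y) = inner x (T y)" for x y
    by (simp add: T_def inner_eq_Re_cinner adj(2))
  have cl: "bounded_clinear T"
    using A adj(1) unfolding T_def bounded_clinear_def by (auto simp: o_def intro: bounded_linear_compose)
  have "positive_operator T"
    by (rule positive_operator.intro[OF bounded_clinear_bounded_linear[OF cl]])
      (metis inner inner_commute, metis inner inner_commute inner_ge_zero)
  from sqrt_op_props[OF cl this]
  have P: "positive_op (abs_op A)" "\<And>x. abs_op A (abs_op A x) = T x"
    unfolding abs_op_def T_def[symmetric] by (auto dest: fun_cong)
  then show "bounded_clinear (abs_op A)" and pos: "positive_operator (abs_op A)"
    by (simp_all add: positive_op_iff)
  have "(norm (abs_op A x))\<^sup>2 = (norm (A x))\<^sup>2"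
    by (simp add: power2_norm_eq_inner inner positive_operator.symmetric[OF pos] P(2))
  then show "norm (abs_op A x) = norm (A x)" by (simp add: power2_eq_iff_nonneg)
qed

section \<open>The smallest positive spectral value\<close>

text \<open>\<open>H\<close> will be \<open>|A|\<close>; the constant \<open>c\<close>, coming from
  the closed range of \<open>A\<close>, makes the infimum \<open>\<mu>\<close> of the form
  positive.\<close>

locale positive_closed_range = positive_operator H
  for H :: "'a::chilbert_space \<Rightarrow> 'a" +
  fixes c :: real
  assumes scaleC: "H (z *\<^sub>C x) = z *\<^sub>C H x"
    and c_pos: "c > 0"
    and below: "x \<in> {x. H x = 0}\<^sup>\<bottom> \<Longrightarrow> c * norm x \<le> norm (H x)"
    and nonzero: "\<exists>x. H x \<noteq> 0"
begin

abbreviation M :: "'a set" where "M \<equiv> {x. H x = 0}\<^sup>\<bottom>"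

lemmas null_props = bounded_linear_subspace_null[OF bounded_linear]
lemmas M_props = subspace_orthogonal_comp[of "{x. H x = 0}"] closed_orthogonal_comp[of "{x. H x = 0}"]

lemma H_in_M: "H x \<in> M"
  by (auto simp: mem_orthogonal_comp_iff simp flip: symmetric)

lemma scaleC_in_M:
  assumes "x \<in> M" shows "z *\<^sub>C x \<in> M"
proof -
  have "inner (z *\<^sub>C x) n = 0" if "H n = 0" for n
  proof -
    have "H (cnj z *\<^sub>C n) = 0"
      using that linear_0[OF bounded_linear.linear[OF bounded_linear_scaleC]] by (simp add: scaleC)
    then show ?thesis using assms by (simp add: inner_scaleC_left mem_orthogonal_comp_iff')
  qed
  then show ?thesis by (simp add: mem_orthogonal_comp_iff')
qed

definition \<mu> :: real where "\<mu> = Inf ((\<lambda>x. inner (H x) x) ` {x \<in> M. norm x = 1})"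

lemma onorm_pos: "onorm H > 0"
  using nonzero onorm_pos_lt[OF bounded_linear] by blast

lemma unit_exists: "{x \<in> M. norm x = 1} \<noteq> {}"
proof -
  obtain x where "H x \<noteq> 0" using nonzero by blast
  then have "(1 / norm (H x)) *\<^sub>R H x \<in> {x \<in> M. norm x = 1}"
    using subspace_scale[OF M_props(1) H_in_M] by simp
  then show ?thesis by blast
qed

lemma form_ge: "x \<in> M \<Longrightarrow> c\<^sup>2 / onorm H * (norm x)\<^sup>2 \<le> inner (H x) x"
proof -
  assume x: "x \<in> M"
  have "(c * norm x)\<^sup>2 \<le> (norm (H x))\<^sup>2" using below[OF x] c_pos by (intro power_mono) auto
  also have "\<dots> \<le> onorm H * inner (H x) x" by (rule norm_sq_le)
  finally show ?thesis using onorm_pos by (simp add: field_simps power_mult_distrib)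
qed

lemma mu_pos: "\<mu> > 0"
proof -
  have "c\<^sup>2 / onorm H \<le> \<mu>" unfolding \<mu>_def
  proof (rule cINF_greatest[OF unit_exists])
    show "c\<^sup>2 / onorm H \<le> inner (H x) x" if "x \<in> {x \<in> M. norm x = 1}" for x
      using form_ge[of x] that by simp
  qed
  moreover have "0 < c\<^sup>2 / onorm H" using c_pos onorm_pos by simp
  ultimately show ?thesis by linarith
qed

lemma mu_le:
  assumes x: "x \<in> M" shows "\<mu> * (norm x)\<^sup>2 \<le> inner (H x) x"
proof (cases "x = 0")
  case False
  have "bdd_below ((\<lambda>x. inner (H x) x) ` {x \<in> M. norm x = 1})"
    by (rule bdd_belowI2[of _ 0]) (rule nonneg)
  then have "\<mu> \<le> inner (H ((1 / norm x) *\<^sub>R x)) ((1 / norm x) *\<^sub>R x)" unfolding \<mu>_def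
    by (rule cINF_lower) (use x False subspace_scale[OF M_props(1)] in simp)
  then show ?thesis using False by (simp add: scale field_simps power2_eq_square)
qed (simp add: zero)

text \<open>A bounded inverse of \<open>H - \<mu>\<close> would bound its norm from below. Since its
  form is nonnegative on \<open>M\<close>, the form itself would then stay above a positive constant
  on unit vectors, contradicting the infimum.\<close>

lemma mu_in_spectrum: "complex_of_real \<mu> \<in> spectrum_op H"
  unfolding spectrum_op_def
proof (intro CollectI notI, elim exE conjE)
  fix S assume S: "bounded_clinear S" "S \<circ> (\<lambda>x. H x - complex_of_real \<mu> *\<^sub>C x) = id"
  define T where "T x = H x - \<mu> *\<^sub>R x" for x
  have ST: "S (T x) = x" for x using fun_cong[OF S(2), of x] by (simp add: T_def scaleC_of_real)
  have linT: "linear T" by (auto intro!: linearI simp: T_def add scale algebra_simps)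
  \<comment> \<open>From \<open>x = S (T x)\<close> and the form bound for \<open>T x\<close>, unit
    vectors satisfy \<open>1 \<le> k * inner (T x) x\<close>; the summand 1 makes \<open>k\<close>
    positive.\<close>
  define k where "k = (onorm S)\<^sup>2 * onorm H + 1"
  have k: "k > 0" using onorm_pos by (simp add: k_def add_nonneg_pos)
  have "\<mu> + 1 / k \<le> inner (H x) x" if x: "x \<in> {x \<in> M. norm x = 1}" for x
  proof -
    have "(norm (T x))\<^sup>2 \<le> onorm H * inner (T x) x"
    proof (rule nonneg_form_norm_le[OF linT M_props(1)])
      show "T x \<in> M" unfolding T_def
        by (intro subspace_diff subspace_scale M_props H_in_M) (use x in simp)
      show "inner (T x) y = inner x (T y)" for x y
        by (simp add: T_def inner_diff_left inner_diff_right symmetric)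
      show "0 \<le> inner (T x) x" if "x \<in> M" for x
        using mu_le[OF that] by (simp add: T_def inner_diff_left power2_norm_eq_inner)
      show "inner (T x) x \<le> onorm H * (norm x)\<^sup>2" for x
      proof -
        have "inner (T x) x \<le> inner (H x) x" using mu_pos by (simp add: T_def inner_diff_left)
        then show ?thesis using form_le[of x] by linarith
      qed
    qed (use x in simp)
    moreover have "1 \<le> (onorm S)\<^sup>2 * (norm (T x))\<^sup>2"
    proof -
      have "norm x \<le> onorm S * norm (T x)"
        using onorm[OF bounded_clinear_bounded_linear[OF S(1)], of "T x"] by (simp add: ST)
      then have "1\<^sup>2 \<le> (onorm S * norm (T x))\<^sup>2" using x by (intro power_mono) auto
      then show ?thesis by (simp add: power_mult_distrib)
    qed
    ultimately have "1 \<le> (onorm S)\<^sup>2 * (onorm H * inner (T x) x)"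
      using mult_left_mono[of "(norm (T x))\<^sup>2" _ "(onorm S)\<^sup>2"] by fastforce
    also have "\<dots> \<le> k * inner (T x) x"
      using mu_le[of x] x by (simp add: k_def T_def inner_diff_left distrib_right power2_norm_eq_inner)
    finally have "1 / k \<le> inner (T x) x" using k by (simp add: field_simps)
    then show ?thesis using x by (simp add: T_def inner_diff_left flip: power2_norm_eq_inner)
  qed
  then have "\<mu> + 1 / k \<le> \<mu>"
    unfolding \<mu>_def by (intro cINF_greatest unit_exists)
  then show False using k by simp
qed

text \<open>On the kernel \<open>H - z\<close> acts as \<open>- z\<close>, and on \<open>M\<close>
  the real part of its form is at least \<open>\<mu> - Re z\<close>. Both subspaces are invariant
  and mutually orthogonal, so Pythagoras combines the two bounds.\<close>

lemma shifted_below: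
  assumes "Re z < \<mu>"
  shows "min (cmod z) (\<mu> - Re z) * norm x \<le> norm (H x - z *\<^sub>C x)"
proof -
  let ?d = "min (cmod z) (\<mu> - Re z)"
  have d: "?d \<ge> 0" using assms by simp
  obtain n where n: "n \<in> {x. H x = 0}" "x - n \<in> M"
    using orthogonal_decomposition[OF null_props] by blast
  define m where "m = x - n"
  have m: "m \<in> M" using n by (simp add: m_def)
  have xnm: "x = n + m" by (simp add: m_def)
  define Lm where "Lm = H m - z *\<^sub>C m"
  have Lm: "Lm \<in> M" unfolding Lm_def by (intro subspace_diff M_props H_in_M scaleC_in_M m)
  have Hx: "H x - z *\<^sub>C x = Lm - z *\<^sub>C n" using n by (simp add: xnm Lm_def add scaleC_add_right)
  have zn: "H (- (z *\<^sub>C n)) = 0"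
    using n linear_0[OF bounded_linear.linear[OF bounded_linear_scaleC]] by (simp add: scaleC neg)
  have "(\<mu> - Re z) * (norm m)\<^sup>2 \<le> inner Lm m"
    using mu_le[OF m] by (simp add: Lm_def inner_diff_left inner_scaleC_self algebra_simps)
  also have "\<dots> \<le> norm Lm * norm m" by (rule norm_cauchy_schwarz)
  finally have "norm m * ((\<mu> - Re z) * norm m) \<le> norm m * norm Lm"
    by (simp add: power2_eq_square mult_ac)
  then have "(\<mu> - Re z) * norm m \<le> norm Lm" by (cases "m = 0") (auto simp: mult_le_cancel_left)
  then have 1: "?d * norm m \<le> norm Lm" using mult_right_mono[of ?d "\<mu> - Re z" "norm m"] by simp
  have 2: "?d * norm n \<le> norm (z *\<^sub>C n)" by (simp add: norm_scaleC mult_right_mono)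
  have "inner n m = 0" using n m by (simp add: mem_orthogonal_comp_iff)
  then have "(?d * norm x)\<^sup>2 = (?d * norm n)\<^sup>2 + (?d * norm m)\<^sup>2"
    using pythagoras[of n m] by (simp add: xnm power_mult_distrib algebra_simps)
  also have "\<dots> \<le> (norm (z *\<^sub>C n))\<^sup>2 + (norm Lm)\<^sup>2"
    by (intro add_mono power_mono 1 2 mult_nonneg_nonneg d norm_ge_zero)
  also have "\<dots> = (norm (H x - z *\<^sub>C x))\<^sup>2"
  proof -
    have "inner Lm (- (z *\<^sub>C n)) = 0" using Lm zn by (simp only: mem_orthogonal_comp_iff') blast
    from pythagoras[OF this] show ?thesis by (simp add: Hx)
  qed
  finally show ?thesis by (rule power2_le_imp_le) simp
qed

text \<open>Below \<open>\<mu>\<close> and away from zero, \<open>H - z\<close> is bounded below and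
  has closed range. A vector orthogonal to the range is killed by \<open>H - cnj z\<close>, for
  which the same lower bound holds; so \<open>H - z\<close> has a bounded inverse.\<close>

lemma spectrum_ge:
  assumes "z \<in> spectrum_op H" "z \<noteq> 0"
  shows "\<mu> \<le> Re z"
proof (rule ccontr)
  assume "\<not> \<mu> \<le> Re z"
  then have z: "Re z < \<mu>" "Re (cnj z) < \<mu>" by auto
  define d where "d = min (cmod z) (\<mu> - Re z)"
  have d: "d > 0" using z assms(2) by (simp add: d_def)
  define L where "L x = H x - z *\<^sub>C x" for x
  have blL: "bounded_linear L" unfolding L_def by (intro bounded_linear_sub bounded_linear bounded_linear_scaleC)
  interpret L: bounded_linear L by (rule blL)
  have belowL: "d * norm x \<le> norm (L x)" for x unfolding d_def L_def by (rule shifted_below[OF z(1)])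
  have "range L = UNIV"
  proof (rule orthogonal_comp_eq_0_imp[OF bounded_linear_subspace_image[OF blL subspace_UNIV]
        closed_image_bounded_below[OF blL subspace_UNIV closed_UNIV d belowL] subspace_UNIV subset_UNIV])
    fix y assume y: "y \<in> (range L)\<^sup>\<bottom>"
    have "inner x (H y - cnj z *\<^sub>C y) = 0" for x
    proof -
      have "inner x (H y - cnj z *\<^sub>C y) = inner (L x) y"
        by (simp add: L_def inner_diff_left inner_diff_right symmetric inner_scaleC_left)
      also have "\<dots> = 0" using y by (simp add: mem_orthogonal_comp_iff)
      finally show ?thesis .
    qed
    then have "H y - cnj z *\<^sub>C y = 0" by (metis inner_eq_zero_iff)
    then have "d * norm y \<le> 0" using shifted_below[OF z(2), of y] by (simp add: d_def)
    then show "y = 0" using d by (simp add: mult_le_0_iff)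
  qed
  moreover have inj: "inj L"
  proof (rule injI)
    fix x y assume "L x = L y"
    then have "d * norm (x - y) \<le> 0" using belowL[of "x - y"] by (simp add: L.diff)
    then show "x = y" using d by (simp add: mult_le_0_iff)
  qed
  ultimately have LS: "L (inv L y) = y" and SL: "inv L (L x) = x" for x y
    by (simp_all add: f_inv_into_f)
  have LC: "L (a *\<^sub>C x) = a *\<^sub>C L x" for a x
    by (simp add: L_def scaleC scaleC_scaleC mult.commute
        linear_diff[OF bounded_linear.linear[OF bounded_linear_scaleC]])
  have "bounded_linear (inv L)"
  proof (rule bounded_linear_intro)
    show "inv L (x + y) = inv L x + inv L y" for x y
      using SL[of "inv L x + inv L y"] by (simp add: L.add LS)
    show "inv L (r *\<^sub>R x) = r *\<^sub>R inv L x" for r x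
      using SL[of "r *\<^sub>R inv L x"] by (simp add: L.scale LS)
    show "norm (inv L x) \<le> norm x * (1 / d)" for x
      using belowL[of "inv L x"] d by (simp add: LS field_simps)
  qed
  moreover have "inv L (a *\<^sub>C x) = a *\<^sub>C inv L x" for a x
    using SL[of "a *\<^sub>C inv L x"] by (simp add: LC LS)
  ultimately have "bounded_clinear (inv L)" by (simp add: bounded_clinear_def)
  moreover have "inv L \<circ> L = id" "L \<circ> inv L = id" using LS SL by (auto simp: fun_eq_iff)
  moreover have "L = (\<lambda>x. H x - z *\<^sub>C x)" by (auto simp: L_def)
  ultimately have "z \<notin> spectrum_op H" by (auto simp: spectrum_op_def)
  then show False using assms(1) by simp
qed

lemma smallest_pos_spectral_eq: "smallest_pos_spectral H = \<mu>"
proof -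
  have "\<mu> \<in> Re ` (spectrum_op H - {0})"
    using mu_in_spectrum mu_pos by (intro image_eqI[of _ _ "complex_of_real \<mu>"]) auto
  then show ?thesis unfolding smallest_pos_spectral_def
    by (rule cInf_eq_minimum) (use spectrum_ge in auto)
qed

end

lemma real_polar_intro:
  assumes A: "bounded_clinear A" "A \<noteq> (\<lambda>x. 0)" "closed (range A)" and pd: "polar_decomposition A Q"
  shows "real_polar A Q (abs_op A) (smallest_pos_spectral (abs_op A))"
proof -
  note bl = bounded_clinear_bounded_linear[OF A(1)]
  note abs = abs_op_props[OF A(1)]
  have null: "abs_op A x = 0 \<longleftrightarrow> A x = 0" for x using abs(3)[of x] by (metis norm_eq_zero)
  obtain c where c: "c > 0" "\<And>x. x \<in> {x. A x = 0}\<^sup>\<bottom> \<Longrightarrow> c * norm x \<le> norm (A x)"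
    using closed_range_bounded_below[OF bl A(3)] by blast
  interpret H: positive_closed_range "abs_op A" c
  proof (rule positive_closed_range.intro[OF abs(2)], unfold_locales)
    show "abs_op A (z *\<^sub>C x) = z *\<^sub>C abs_op A x" for z x by (rule bounded_clinear_scaleC[OF abs(1)])
    show "\<exists>x. abs_op A x \<noteq> 0" using A(2) by (auto simp: null)
    show "c > 0" by (rule c)
    show "c * norm x \<le> norm (abs_op A x)" if "x \<in> {x. abs_op A x = 0}\<^sup>\<bottom>" for x
      using c(2)[of x] that by (simp add: abs(3) null)
  qed
  have Q: "bounded_clinear Q" "\<And>x. x \<in> orth_compl (null_space Q) \<Longrightarrow> norm (Q x) = norm x"
    and nQ: "null_space Q = null_space A" and AQ: "A = Q \<circ> abs_op A"
    using pd unfolding polar_decomposition_def partial_isometry_def by blast+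
  show ?thesis
  proof (rule real_polar.intro)
    show "A x = Q (abs_op A x)" for x using fun_cong[OF AQ, of x] by simp
    show "Q x = 0 \<longleftrightarrow> A x = 0" for x using nQ by (auto simp: null_space_def)
    show "norm (Q x) = norm x" if "x \<in> {x. A x = 0}\<^sup>\<bottom>" for x
    proof (rule Q(2))
      show "x \<in> orth_compl (null_space Q)"
        using that orth_compl_eq_orthogonal_comp[OF null_space_scaleC[OF A(1)]]
        unfolding nQ by (simp only: null_space_def)
    qed
    show "smallest_pos_spectral (abs_op A) > 0"
      unfolding H.smallest_pos_spectral_eq by (rule H.mu_pos)
    show "smallest_pos_spectral (abs_op A) * (norm x)\<^sup>2 \<le> inner (abs_op A x) x"
      if "x \<in> {x. A x = 0}\<^sup>\<bottom>" for x
      unfolding H.smallest_pos_spectral_eq using that by (intro H.mu_le) (simp add: null)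
  qed (auto simp: null H.symmetric bl bounded_clinear_bounded_linear[OF Q(1)] H.bounded_linear)
qed

section \<open>Gaps\<close>

lemma orth_proj_eqI:
  assumes "p \<in> W" "v - p \<in> W\<^sup>\<bottom>" "subspace W" "orth_compl W = W\<^sup>\<bottom>"
  shows "orth_proj W v = p"
  unfolding orth_proj_def
proof (rule the_equality)
  fix y assume y: "y \<in> W \<and> v - y \<in> orth_compl W"
  then have "v - p - (v - y) \<in> W\<^sup>\<bottom>" using assms by (metis subspace_diff subspace_orthogonal_comp)
  moreover have "y - p \<in> W" using y assms by (simp add: subspace_diff)
  ultimately have "inner (y - p) (y - p) = 0" by (simp add: mem_orthogonal_comp_iff)
  then show "y = p" by simp
qed (use assms in simp)

text \<open>Homogeneous form of the gap, with the projection given by its orthogonality property so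
  that the real estimates can use it.\<close>

lemma norm_diff_le_gap_from:
  assumes V: "subspace V" and W: "subspace W" "closed W" "\<And>c x. x \<in> W \<Longrightarrow> c *\<^sub>C x \<in> W"
    and v: "v \<in> V" and p: "p \<in> W" "v - p \<in> W\<^sup>\<bottom>"
  shows "norm (v - p) \<le> gap_from V W * norm v"
proof (cases "v = 0")
  case True
  then have "inner p p = 0" using p unfolding mem_orthogonal_comp_iff by auto
  then show ?thesis using True by simp
next
  case False
  note oc = orth_compl_eq_orthogonal_comp[OF W(3)]
  let ?S = "{norm (v - orth_proj W v) | v. v \<in> V \<and> norm v = 1}"
  define r where "r = 1 / norm v"
  have r: "r > 0" using False by (simp add: r_def)
  \<comment> \<open>The supremum is an upper bound only of a set bounded above; residuals of unit
    vectors have norm at most 1.\<close>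
  have "bdd_above ?S"
  proof (rule bdd_aboveI)
    fix s assume "s \<in> ?S"
    then obtain u where u: "s = norm (u - orth_proj W u)" "norm u = 1" by blast
    obtain q where q: "q \<in> W" "u - q \<in> W\<^sup>\<bottom>" using orthogonal_decomposition[OF W(1,2)] by blast
    then have "inner (u - q) q = 0" by (auto simp: mem_orthogonal_comp_iff')
    from norm_le_norm_add_orthogonal[OF this] show "s \<le> 1"
      using u orth_proj_eqI[OF q W(1) oc] by simp
  qed
  moreover have "orth_proj W (r *\<^sub>R v) = r *\<^sub>R p"
  proof (rule orth_proj_eqI[OF _ _ W(1) oc])
    show "r *\<^sub>R p \<in> W" by (intro subspace_scale W p)
    have "r *\<^sub>R (v - p) \<in> W\<^sup>\<bottom>" by (intro subspace_scale subspace_orthogonal_comp p)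
    then show "r *\<^sub>R v - r *\<^sub>R p \<in> W\<^sup>\<bottom>" by (simp add: scaleR_right_diff_distrib)
  qed
  moreover have "r *\<^sub>R v \<in> V \<and> norm (r *\<^sub>R v) = 1"
    using v V False by (simp add: subspace_scale r_def)
  ultimately have "norm (r *\<^sub>R v - r *\<^sub>R p) \<le> Sup ?S"
    by (intro cSup_upper) force+
  moreover have "norm (r *\<^sub>R v - r *\<^sub>R p) = r * norm (v - p)"
    using r by (simp flip: scaleR_right_diff_distrib)
  moreover have "V \<noteq> {0}" using v False by blast
  ultimately have "r * norm (v - p) \<le> gap_from V W" by (simp add: gap_from_def)
  then show ?thesis using False by (simp add: r_def field_simps)
qed

lemma gap_commute: "gap V W = gap W V"
  by (simp add: gap_def max.commute)

lemma bound_first_if_gap: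
  assumes A1: "bounded_clinear A1" "A1 \<noteq> (\<lambda>x. 0)" "closed (range A1)" "polar_decomposition A1 Q1"
    and A2: "bounded_clinear A2" "A2 \<noteq> (\<lambda>x. 0)" "closed (range A2)" "polar_decomposition A2 Q2"
    and \<sigma>: "\<sigma>1 = smallest_pos_spectral (abs_op A1)" "\<sigma>2 = smallest_pos_spectral (abs_op A2)"
    and gap: "gap (range A1) (range A2) < 1 \<or> gap (null_space A1) (null_space A2) < 1"
  shows "onorm (\<lambda>x. Q1 x - Q2 x)
    \<le> (2 / (\<sigma>1 + \<sigma>2) + 1 / \<sigma>1) * onorm (\<lambda>x. A1 x - A2 x)"
proof -
  interpret real_polar_pair A1 Q1 "abs_op A1" \<sigma>1 A2 Q2 "abs_op A2" \<sigma>2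
    unfolding real_polar_pair_def using real_polar_intro[OF A1] real_polar_intro[OF A2] \<sigma> by simp
  have "onorm (\<lambda>x. Q1 x - Q2 x) \<le> 2 * err / (\<sigma>1 + \<sigma>2) + err / \<sigma>1"
  proof (rule bound_first)
    fix y assume e: "err < \<sigma>1" and y: "y \<in> range A2" "y \<in> (range A1)\<^sup>\<bottom>"
    show "y = 0"
      using gap
    proof
      assume "gap (range A1) (range A2) < 1"
      then have g: "gap_from (range A2) (range A1) < 1" by (simp add: gap_def)
      \<comment> \<open>The projection of \<open>y\<close> onto \<open>range A1\<close> is zero, so
        the gap compares \<open>norm y\<close> with itself.\<close>
      have "norm (y - 0) \<le> gap_from (range A2) (range A1) * norm y"
        using y by (intro norm_diff_le_gap_from P2.subspace_range P1.subspace_range A1(3)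
            range_scaleC[OF A1(1)]) (auto simp: subspace_0 P1.subspace_range)
      then have "(1 - gap_from (range A2) (range A1)) * norm y \<le> 0" by (simp add: algebra_simps)
      then show "y = 0" using g by (simp add: mult_le_0_iff)
    next
      let ?N1 = "null_space A1" and ?N2 = "null_space A2"
      assume "gap ?N1 ?N2 < 1"
      then have g: "gap_from ?N1 ?N2 < 1" "gap_from ?N2 ?N1 < 1" by (simp_all add: gap_def)
      \<comment> \<open>Truncation at zero gives nonnegativity by construction.\<close>
      define g where "g = max 0 (gap ?N1 ?N2)"
      have sub: "subspace ?N1" "closed ?N1" "subspace ?N2" "closed ?N2"
        using P1.null_space_props P2.null_space_props by (simp_all add: null_space_def)
      show "y = 0"
      proof (rule range_inj_if_null_gap[OF _ _ _ _ e y])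
        show "0 \<le> g" "g < 1" using \<open>gap ?N1 ?N2 < 1\<close> by (simp_all add: g_def)
        show "norm (v - p) \<le> g * norm v" if "A2 v = 0" "A1 p = 0" "v - p \<in> P1.coimage" for v p
        proof -
          have "norm (v - p) \<le> gap_from ?N2 ?N1 * norm v"
            using that by (intro norm_diff_le_gap_from sub null_space_scaleC[OF A1(1)])
              (auto simp: null_space_def)
          also have "\<dots> \<le> g * norm v" by (intro mult_right_mono) (auto simp: g_def gap_def)
          finally show ?thesis .
        qed
        show "norm (v - p) \<le> g * norm v" if "A1 v = 0" "A2 p = 0" "v - p \<in> P2.coimage" for v p
        proof -
          have "norm (v - p) \<le> gap_from ?N1 ?N2 * norm v"
            using that by (intro norm_diff_le_gap_from sub null_space_scaleC[OF A2(1)])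
              (auto simp: null_space_def)
          also have "\<dots> \<le> g * norm v" by (intro mult_right_mono) (auto simp: g_def gap_def)
          finally show ?thesis .
        qed
      qed
    qed
  qed
  then show ?thesis by (simp add: err_def algebra_simps)
qed

theorem theorem1p2:
  fixes A1 A2 Q1 Q2 :: "'h::chilbert_space \<Rightarrow> 'k::chilbert_space"
    and \<sigma>1 \<sigma>2 :: real
  assumes "bounded_clinear A1" and "bounded_clinear A2"
    and "A1 \<noteq> (\<lambda>x. 0)" and "A2 \<noteq> (\<lambda>x. 0)"
    and "closed (range A1)" and "closed (range A2)"
    and "polar_decomposition A1 Q1" and "polar_decomposition A2 Q2"
    and "\<sigma>1 = smallest_pos_spectral (abs_op A1)"
    and "\<sigma>2 = smallest_pos_spectral (abs_op A2)"
  shows "onorm (\<lambda>x. Q1 x - Q2 x)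
           \<le> (3 / (\<sigma>1 + \<sigma>2) + 1 / min \<sigma>1 \<sigma>2) * onorm (\<lambda>x. A1 x - A2 x)
       \<and> (gap (range A1) (range A2) < 1 \<or> gap (null_space A1) (null_space A2) < 1 \<longrightarrow>
           onorm (\<lambda>x. Q1 x - Q2 x)
             \<le> (3 / (\<sigma>1 + \<sigma>2) + 1 / max \<sigma>1 \<sigma>2) * onorm (\<lambda>x. A1 x - A2 x)
         \<and> onorm (\<lambda>x. Q1 x - Q2 x) \<le> 5 / (\<sigma>1 + \<sigma>2) * onorm (\<lambda>x. A1 x - A2 x))"
proof -
  note A1 = assms(1,3,5,7) and A2 = assms(2,4,6,8)
  interpret real_polar_pair A1 Q1 "abs_op A1" \<sigma>1 A2 Q2 "abs_op A2" \<sigma>2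
    unfolding real_polar_pair_def using real_polar_intro[OF A1] real_polar_intro[OF A2] assms(9,10) by simp
  let ?E = "onorm (\<lambda>x. A1 x - A2 x)" and ?D = "onorm (\<lambda>x. Q1 x - Q2 x)"
  have E: "?E \<ge> 0" using err_nonneg by (simp add: err_def)
  have s: "\<sigma>1 > 0" "\<sigma>2 > 0" by (rule P1.sigma_pos P2.sigma_pos)+
  \<comment> \<open>The estimates above hold with constant 2; this inequality weakens it to
    3.\<close>
  have 23: "2 / (\<sigma>1 + \<sigma>2) \<le> 3 / (\<sigma>1 + \<sigma>2)" using s by (intro divide_right_mono) auto
  have "?D \<le> (2 / (\<sigma>1 + \<sigma>2) + 1 / min \<sigma>1 \<sigma>2) * ?E"
    using bound_min by (simp add: err_def algebra_simps)
  also have "\<dots> \<le> (3 / (\<sigma>1 + \<sigma>2) + 1 / min \<sigma>1 \<sigma>2) * ?E"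
    using 23 by (intro mult_right_mono add_right_mono E)
  finally have min: "?D \<le> (3 / (\<sigma>1 + \<sigma>2) + 1 / min \<sigma>1 \<sigma>2) * ?E" .
  have "?D \<le> (3 / (\<sigma>1 + \<sigma>2) + 1 / max \<sigma>1 \<sigma>2) * ?E \<and> ?D \<le> 5 / (\<sigma>1 + \<sigma>2) * ?E"
    if gap: "gap (range A1) (range A2) < 1 \<or> gap (null_space A1) (null_space A2) < 1"
  proof -
    have "?D \<le> (2 / (\<sigma>1 + \<sigma>2) + 1 / max \<sigma>1 \<sigma>2) * ?E"
    proof (cases "\<sigma>2 \<le> \<sigma>1")
      case True
      then show ?thesis using bound_first_if_gap[OF A1 A2 assms(9,10) gap] by (simp add: max_def)
    next
      case False
      have "gap (range A2) (range A1) < 1 \<or> gap (null_space A2) (null_space A1) < 1"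
        using gap by (simp add: gap_commute)
      \<comment> \<open>The larger spectral value now belongs to the second operator, so the roles
        are exchanged; \<open>onorm_neg\<close> restores the order of the differences.\<close>
      from bound_first_if_gap[OF A2 A1 assms(10,9) this] show ?thesis
        using False onorm_neg[of "\<lambda>x. A1 x - A2 x"] onorm_neg[of "\<lambda>x. Q1 x - Q2 x"]
        by (simp add: max_def add.commute)
    qed
    moreover have "\<dots> \<le> (3 / (\<sigma>1 + \<sigma>2) + 1 / max \<sigma>1 \<sigma>2) * ?E"
      using 23 by (intro mult_right_mono add_right_mono E)
    \<comment> \<open>The sum of the two values is at most twice their maximum, which turns
      \<open>3 + 2\<close> into the constant 5.\<close>
    moreover have "1 / max \<sigma>1 \<sigma>2 \<le> 2 / (\<sigma>1 + \<sigma>2)" using s by (simp add: field_simps max_def)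
    then have "(3 / (\<sigma>1 + \<sigma>2) + 1 / max \<sigma>1 \<sigma>2) * ?E \<le> (3 / (\<sigma>1 + \<sigma>2) + 2 / (\<sigma>1 + \<sigma>2)) * ?E"
      by (intro mult_right_mono add_left_mono E)
    moreover have "3 / (\<sigma>1 + \<sigma>2) + 2 / (\<sigma>1 + \<sigma>2) = 5 / (\<sigma>1 + \<sigma>2)"
      by (simp flip: add_divide_distrib)
    ultimately show ?thesis by auto
  qed
  then show ?thesis using min by blast
qed

end
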